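(* Let $\mathbb{M}\in\{\mathbb{E}^d,\mathbb{H}^d\}$, $d\ge2$, and let $B\subset\mathbb{M}$ be a ball. Among all $d$-dimensional simplices in $\mathbb{M}$ containing $B$, the ones with minimal volume are exactly the regular simplices circumscribed about $B$.
   Context: A regular simplex has all edges of equal length. A simplex is circumscribed about the ball $B$ if it contains $B$ and every facet of it touches $B$ (equivalently, $B$ is its inscribed ball). Convexity in $\mathbb{H}^d$ is with respect to hyperbolic geodesic segments. *)

theory Defs
  imports "HOL-Analysis.Analysis"
begin

text \<open>The two model geometries: Euclidean space E^d = real^'n, and hyperbolic
  space H^d in the Beltrami--Klein model (the open unit ball of real^'n), where
  hyperbolic geodesics are Euclidean straight segments, so hyperbolic convexity
  coincides with Euclidean convexity inside the unit ball.\<close>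

datatype geom = Euclid | Hyp

definition mspace :: "geom \<Rightarrow> (real^'n) set" where
  "mspace M = (case M of Euclid \<Rightarrow> UNIV | Hyp \<Rightarrow> ball 0 1)"

definition mdist :: "geom \<Rightarrow> real^'n \<Rightarrow> real^'n \<Rightarrow> real" where
  "mdist M x y = (case M of Euclid \<Rightarrow> dist x y
     | Hyp \<Rightarrow> arcosh ((1 - x \<bullet> y) / sqrt ((1 - (norm x)\<^sup>2) * (1 - (norm y)\<^sup>2))))"

definition mvol :: "geom \<Rightarrow> (real^'n) set \<Rightarrow> ennreal" where
  "mvol M S = (case M of Euclid \<Rightarrow> emeasure lebesgue S
     | Hyp \<Rightarrow> (\<integral>\<^sup>+ x. indicator S x *
          ennreal ((1 - (norm x)\<^sup>2) powr (- (real CARD('n) + 1) / 2)) \<partial>lborel))"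

definition mball :: "geom \<Rightarrow> real^'n \<Rightarrow> real \<Rightarrow> (real^'n) set" where
  "mball M c r = {x \<in> mspace M. mdist M c x \<le> r}"

definition msimplex_vertices :: "geom \<Rightarrow> (real^'n) set \<Rightarrow> bool" where
  "msimplex_vertices M V \<longleftrightarrow> finite V \<and> card V = CARD('n) + 1 \<and>
     \<not> affine_dependent V \<and> V \<subseteq> mspace M"

definition mregular :: "geom \<Rightarrow> (real^'n) set \<Rightarrow> bool" where
  "mregular M V \<longleftrightarrow> (\<forall>u\<in>V. \<forall>v\<in>V. \<forall>u'\<in>V. \<forall>v'\<in>V.
      u \<noteq> v \<and> u' \<noteq> v' \<longrightarrow> mdist M u v = mdist M u' v')"

definition circumscribed :: "(real^'n) set \<Rightarrow> (real^'n) set \<Rightarrow> bool" where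
  "circumscribed B V \<longleftrightarrow> B \<subseteq> convex hull V \<and>
     (\<forall>v\<in>V. convex hull (V - {v}) \<inter> B \<noteq> {})"

end

theory Submission
  imports Defs
begin

text \<open>
Move the centre of the ball to the origin by an isometry; both volumes then have a radial, midpoint
convex density. Symmetrise a simplex containing the ball along one of its edges: every line parallel
to the edge meets the simplex in a segment, which is shifted so that its midpoint lies on the
hyperplane through the origin orthogonal to the edge. The result is again a simplex, it still contains
the ball, and its volume is not larger. A volume minimiser (it exists by compactness among the simplices with
vertices in a fixed ball) touches the ball with all its facets, since otherwise a facet could be pushed
inwards. Applying this also to the symmetrised simplex gives equality in a triangle
inequality between the normals of the two facets meeting the edge in one end each, hence the minimiser is symmetric
with respect to that hyperplane. Doing this for all edges determines the Gram matrix of the vertices.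
Conversely, a regular circumscribed simplex has that Gram matrix, so it is congruent to the minimiser.
\<close>

section \<open>Barycentric coordinates\<close>

text \<open>In the Klein model a ball centred at the origin is a Euclidean ball, so after centring
  the two geometries differ only in the density, and one argument over an abstract density serves
  both. The obstacle is uniqueness. For constant density symmetrisation leaves the volume unchanged,
  so no strict volume inequality can single out the regular simplex. Its role is taken by the
  touching of the facets: the symmetrised simplex is again a minimiser, and one of its facet normals
  is the average of an old normal and the mirror image of another. If these two were not parallel,
  the average would be too short and a gap between facet and ball would remain. The hyperbolic
  density blows up at the unit sphere, so compactness is available only for vertices in a ball of
  radius \<open>R\<close> below 1. The resulting Gram matrix depends only on \<rho> and the
  dimension, so \<open>R\<close> may be chosen after the two simplices to be compared. In the
  converse, the metric serves to show that a regular simplex circumscribed about a central ball has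
  a Gram matrix with only two values.\<close>

text \<open>The functions \<open>x \<mapsto> \<alpha> k + p k \<bullet> x\<close> are the barycentric coordinates of the simplex with
  vertices \<open>v k\<close>; there are \<open>CARD('n) + 1\<close> of them when the index type is \<open>'n option\<close>.\<close>

definition dual_system :: "('k::finite \<Rightarrow> real^'n) \<Rightarrow> ('k \<Rightarrow> real) \<Rightarrow> ('k \<Rightarrow> real^'n) \<Rightarrow> bool" where
  "dual_system v \<alpha> p \<longleftrightarrow> (\<forall>k l. \<alpha> k + p k \<bullet> v l = (if k = l then 1 else 0))"

lemma dual_systemD: "dual_system v \<alpha> p \<Longrightarrow> \<alpha> k + p k \<bullet> v l = (if k = l then 1 else 0)"
  by (simp add: dual_system_def)

lemma dual_system_inj: "dual_system v \<alpha> p \<Longrightarrow> inj v"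
  by (rule injI) (metis dual_systemD zero_neq_one)

text \<open>Pairing an affine relation between the vertices with the k-th coordinate function leaves
  only its k-th coefficient.\<close>

lemma dual_system_affine_independent:
  fixes v :: "'k::finite \<Rightarrow> real^'n"
  assumes "dual_system v \<alpha> p"
  shows "\<not> affine_dependent (range v)"
proof
  have inj: "inj v" using assms by (rule dual_system_inj)
  assume "affine_dependent (range v)"
  then obtain u where u: "sum u (range v) = 0" "(\<Sum>x\<in>range v. u x *\<^sub>R x) = 0"
    and "\<exists>x\<in>range v. u x \<noteq> 0"
    by (subst (asm) affine_dependent_explicit_finite) auto
  then obtain k where k: "u (v k) \<noteq> 0" by auto
  have s: "(\<Sum>l\<in>UNIV. u (v l)) = 0" "(\<Sum>l\<in>UNIV. u (v l) *\<^sub>R v l) = 0"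
    using u inj by (simp_all add: sum.reindex)
  have "u (v k) = (\<Sum>l\<in>UNIV. u (v l) * (\<alpha> k + p k \<bullet> v l))"
    using assms by (simp add: dual_system_def if_distrib[of "(*) _"] cong: if_cong)
  also have "\<dots> = \<alpha> k * (\<Sum>l\<in>UNIV. u (v l)) + p k \<bullet> (\<Sum>l\<in>UNIV. u (v l) *\<^sub>R v l)"
    by (simp add: algebra_simps sum.distrib sum_distrib_left inner_sum_right)
  finally show False using s k by simp
qed

lemma dual_system_combination:
  assumes "dual_system v \<alpha> p" "(\<Sum>l\<in>UNIV. c l) = 1"
  shows "\<alpha> k + p k \<bullet> (\<Sum>l\<in>UNIV. c l *\<^sub>R v l) = c k"
proof -
  have "\<alpha> k + p k \<bullet> (\<Sum>l\<in>UNIV. c l *\<^sub>R v l) = \<alpha> k * (\<Sum>l\<in>UNIV. c l) + p k \<bullet> (\<Sum>l\<in>UNIV. c l *\<^sub>R v l)"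
    by (simp add: assms(2))
  also have "\<dots> = (\<Sum>l\<in>UNIV. c l * (\<alpha> k + p k \<bullet> v l))"
    by (simp add: algebra_simps sum.distrib sum_distrib_left inner_sum_right)
  also have "\<dots> = c k"
    using assms(1) by (simp add: dual_system_def if_distrib[of "(*) _"] cong: if_cong)
  finally show ?thesis .
qed

text \<open>With index type \<open>'n option\<close> there are enough vertices to span the whole
  space affinely, so every \<open>x\<close> is an affine combination;
  \<open>dual_system_combination\<close> identifies its coefficients.\<close>

lemma dual_system_decomp:
  fixes v :: "'n option \<Rightarrow> real^'n"
  assumes "dual_system v \<alpha> p"
  shows "(\<Sum>k\<in>UNIV. \<alpha> k + p k \<bullet> x) = 1" "(\<Sum>k\<in>UNIV. (\<alpha> k + p k \<bullet> x) *\<^sub>R v k) = x"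
proof -
  have inj: "inj v" using assms by (rule dual_system_inj)
  have "card (range v) = Suc (DIM(real^'n))"
    using inj by (simp add: card_image card_UNIV_option)
  then have "affine hull (range v) = UNIV"
    using dual_system_affine_independent[OF assms] affine_independent_span_eq by blast
  then have "x \<in> affine hull (range v)" by simp
  then obtain u where u: "sum u (range v) = 1" "(\<Sum>x\<in>range v. u x *\<^sub>R x) = x"
    by (auto simp: affine_hull_finite)
  have s: "(\<Sum>l\<in>UNIV. u (v l)) = 1" "(\<Sum>l\<in>UNIV. u (v l) *\<^sub>R v l) = x"
    using u inj by (simp_all add: sum.reindex)
  have e: "\<alpha> k + p k \<bullet> x = u (v k)" for k
    using dual_system_combination[OF assms s(1), of k] by (simp add: s(2))
  show "(\<Sum>k\<in>UNIV. \<alpha> k + p k \<bullet> x) = 1" "(\<Sum>k\<in>UNIV. (\<alpha> k + p k \<bullet> x) *\<^sub>R v k) = x"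
    using s by (simp_all add: e)
qed

text \<open>An affine function is determined by its values at the vertices. This is how the vectors
  \<open>p k\<close> are later computed from inner products or distances.\<close>

lemma dual_system_affine_eqI:
  fixes v :: "'n option \<Rightarrow> real^'n"
  assumes "dual_system v \<alpha> p" and eq: "\<And>l. a + b \<bullet> v l = a' + b' \<bullet> v l"
  shows "a = a'" "b = b'"
proof -
  have *: "c + d \<bullet> x = (\<Sum>l\<in>UNIV. (\<alpha> l + p l \<bullet> x) * (c + d \<bullet> v l))" for c d x
  proof -
    have "c + d \<bullet> x = c * (\<Sum>k\<in>UNIV. \<alpha> k + p k \<bullet> x) + d \<bullet> (\<Sum>k\<in>UNIV. (\<alpha> k + p k \<bullet> x) *\<^sub>R v k)"
      by (simp add: dual_system_decomp[OF assms(1)])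
    then show ?thesis
      by (simp add: algebra_simps sum.distrib sum_distrib_left sum_distrib_right inner_sum_right)
  qed
  have x: "a + b \<bullet> x = a' + b' \<bullet> x" for x
    by (simp only: *[of a b x] *[of a' b' x] eq)
  from x[of 0] show "a = a'" by simp
  with x have "b \<bullet> x = b' \<bullet> x" for x by simp
  then show "b = b'" by (metis vector_eq_rdot)
qed

lemma dual_system_hull:
  fixes v :: "'n option \<Rightarrow> real^'n"
  assumes "dual_system v \<alpha> p"
  shows "convex hull (range v) = {x. \<forall>k. 0 \<le> \<alpha> k + p k \<bullet> x}"
proof
  have "{x. \<forall>k. 0 \<le> \<alpha> k + p k \<bullet> x} = (\<Inter>k. {x. p k \<bullet> x \<ge> - \<alpha> k})"
    by (auto simp: algebra_simps) (smt (verit))+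
  then have "convex {x. \<forall>k. 0 \<le> \<alpha> k + p k \<bullet> x}"
    by (simp add: convex_INT convex_halfspace_ge)
  then show "convex hull (range v) \<subseteq> {x. \<forall>k. 0 \<le> \<alpha> k + p k \<bullet> x}"
    using assms by (intro hull_minimal) (auto simp: dual_system_def)
next
  show "{x. \<forall>k. 0 \<le> \<alpha> k + p k \<bullet> x} \<subseteq> convex hull (range v)"
  proof
    fix x assume "x \<in> {x. \<forall>k. 0 \<le> \<alpha> k + p k \<bullet> x}"
    then have "(\<Sum>k\<in>UNIV. (\<alpha> k + p k \<bullet> x) *\<^sub>R v k) \<in> convex hull (range v)"
      using dual_system_decomp[OF assms]
      by (intro convex_sum convex_convex_hull) (auto intro: hull_inc)
    then show "x \<in> convex hull (range v)" by (simp add: dual_system_decomp[OF assms])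
  qed
qed

lemma inner_sgn_self: "(u::real^'n) \<bullet> sgn u = norm u"
  by (cases "u = 0") (simp_all add: sgn_div_norm power2_norm_eq_inner[symmetric] power2_eq_square field_simps)

text \<open>On the ball the k-th coordinate has minimum
  \<open>\<alpha> k - \<rho> * norm (p k)\<close>, attained at \<open>- \<rho>\<close> times the
  unit vector of \<open>p k\<close>. Equality for one \<open>k\<close> means that the facet opposite
  \<open>v k\<close> touches the ball.\<close>

lemma dual_system_cball:
  fixes v :: "'n option \<Rightarrow> real^'n"
  assumes "dual_system v \<alpha> p" "0 \<le> \<rho>"
  shows "cball 0 \<rho> \<subseteq> convex hull (range v) \<longleftrightarrow> (\<forall>k. \<rho> * norm (p k) \<le> \<alpha> k)"
proof
  assume L: "cball 0 \<rho> \<subseteq> convex hull (range v)"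
  show "\<forall>k. \<rho> * norm (p k) \<le> \<alpha> k"
  proof
    fix k
    have "(-\<rho>) *\<^sub>R sgn (p k) \<in> cball 0 \<rho>"
      using assms(2) by (simp add: norm_sgn)
    then have "0 \<le> \<alpha> k + p k \<bullet> ((-\<rho>) *\<^sub>R sgn (p k))"
      using L unfolding dual_system_hull[OF assms(1)] by blast
    then show "\<rho> * norm (p k) \<le> \<alpha> k" by (simp add: inner_sgn_self)
  qed
next
  assume R: "\<forall>k. \<rho> * norm (p k) \<le> \<alpha> k"
  show "cball 0 \<rho> \<subseteq> convex hull (range v)"
  proof
    fix x :: "real^'n" assume "x \<in> cball 0 \<rho>"
    then have x: "norm x \<le> \<rho>" by simp
    have "0 \<le> \<alpha> k + p k \<bullet> x" for k
    proof -
      have "- (p k \<bullet> x) \<le> norm (p k) * norm x"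
        by (metis Cauchy_Schwarz_ineq2 abs_le_D2)
      also have "\<dots> \<le> norm (p k) * \<rho>" using x by (simp add: mult_left_mono)
      finally show ?thesis using R[rule_format, of k] by (simp add: mult.commute)
    qed
    then show "x \<in> convex hull (range v)" by (simp add: dual_system_hull[OF assms(1)])
  qed
qed

text \<open>A hull with interior has full affine dimension, which the given number of points reaches
  only without repetition or dependence. Hence families whose hull contains a ball are never
  degenerate.\<close>

lemma interior_imp_affine_independent:
  fixes V :: "(real^'n) set"
  assumes "finite V" "card V \<le> CARD('n) + 1" "interior (convex hull V) \<noteq> {}"
  shows "\<not> affine_dependent V" "card V = CARD('n) + 1"
proof -
  have "aff_dim V = int (CARD('n))"
    using assms(3) by (metis aff_dim_convex_hull aff_dim_nonempty_interior DIM_cart DIM_real mult.right_neutral)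
  moreover have "aff_dim V \<le> int (card V) - 1"
    using aff_dim_le_card assms(1) by blast
  ultimately show "card V = CARD('n) + 1" using assms(2) by linarith
  with \<open>aff_dim V = int (CARD('n))\<close> show "\<not> affine_dependent V"
    using assms(1) by (simp add: affine_independent_iff_card)
qed

lemma dual_system_exists_of_independent:
  fixes v :: "'k::finite \<Rightarrow> real^'n"
  assumes inj: "inj v" and ind: "\<not> affine_dependent (range v)"
  shows "\<exists>\<alpha> p. dual_system v \<alpha> p"
proof -
  have "\<exists>a q. \<forall>l. a + q \<bullet> v l = (if k = l then 1 else 0)" for k
  proof -
    have "independent ((\<lambda>x. - v k + x) ` (range v - {v k}))"
      using ind affine_dependent_iff_dependent2[of "v k" "range v"] by auto
    \<comment> \<open>The edges leaving \<open>v k\<close> are linearly independent, so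
      \<open>g\<close> may be prescribed to drop by 1 along each of them: a coordinate that is 1 at
      \<open>v k\<close> then falls to 0 at all other vertices.\<close>
    then obtain g :: "real^'n \<Rightarrow> real" where g: "linear g"
      "\<And>x. x \<in> (\<lambda>x. - v k + x) ` (range v - {v k}) \<Longrightarrow> g x = -1"
      using linear_independent_extend[of _ "\<lambda>_. -1::real"] by metis
    define q where "q = adjoint g 1"
    have q: "g x = q \<bullet> x" for x
      unfolding q_def using adjoint_works[OF g(1), of x 1]
      by (simp add: inner_commute)
    have "(1 - q \<bullet> v k) + q \<bullet> v l = (if k = l then 1 else 0)" for l
    proof (cases "k = l")
      case False
      then have "v l \<noteq> v k" using inj by (auto dest: injD)
      then have "g (- v k + v l) = -1" by (intro g(2)) auto
      then show ?thesis using False by (simp add: q inner_diff_right inner_add_right)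
    qed simp
    then show ?thesis by blast
  qed
  then have "\<forall>k. \<exists>a. \<exists>q. \<forall>l. a + q \<bullet> v l = (if k = l then 1 else 0)" by blast
  then show ?thesis unfolding dual_system_def by metis
qed

lemma dual_system_exists:
  fixes v :: "'n option \<Rightarrow> real^'n"
  assumes "interior (convex hull (range v)) \<noteq> {}"
  shows "\<exists>\<alpha> p. dual_system v \<alpha> p"
proof -
  have "card (range v) \<le> CARD('n) + 1"
    using card_image_le[of UNIV v] by (simp add: card_UNIV_option)
  from interior_imp_affine_independent[OF _ this assms]
  have "\<not> affine_dependent (range v)" "card (range v) = CARD('n) + 1" by auto
  moreover from this(2) have "inj v"
    by (intro eq_card_imp_inj_on) (auto simp: card_UNIV_option)
  ultimately show ?thesis by (simp add: dual_system_exists_of_independent)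
qed

lemma cball_interior_nonempty:
  fixes S :: "(real^'n) set"
  assumes "cball 0 \<rho> \<subseteq> S" "\<rho> > 0"
  shows "interior S \<noteq> {}"
  using assms interior_mono[OF assms(1)] by (auto simp: interior_cball)

section \<open>Volume preserving maps\<close>

text \<open>Phrased as a pushforward identity, from which substitution in integrals and closure
  under composition are immediate.\<close>

definition preserves_lborel :: "(real^'m \<Rightarrow> real^'m) \<Rightarrow> bool" where
  "preserves_lborel T \<longleftrightarrow> T \<in> borel_measurable borel \<and> distr lborel borel T = lborel"

lemma preserves_lborel_nn_integral:
  assumes "preserves_lborel T" "g \<in> borel_measurable borel"
  shows "(\<integral>\<^sup>+ x. g (T x) \<partial>lborel) = (\<integral>\<^sup>+ x. g x \<partial>lborel)"
  using assms nn_integral_distr[of T lborel borel g] by (simp add: preserves_lborel_def)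

lemma preserves_lborel_comp:
  assumes "preserves_lborel S" "preserves_lborel T"
  shows "preserves_lborel (\<lambda>x. S (T x))"
proof -
  have [measurable]: "S \<in> borel_measurable borel" "T \<in> borel_measurable borel"
    using assms by (auto simp: preserves_lborel_def)
  have "distr lborel borel (\<lambda>x. S (T x)) = distr (distr lborel borel T) borel S"
    by (subst distr_distr) (auto simp: comp_def)
  then show ?thesis using assms by (simp add: preserves_lborel_def)
qed

lemma preserves_lborel_translation: "preserves_lborel ((+) a)"
  by (simp add: preserves_lborel_def lborel_distr_plus)

text \<open>Boxes determine Lebesgue measure. The preimage of a box is its image under the inverse
  map, whose determinant also has absolute value 1.\<close>

lemma preserves_lborel_linear:
  fixes T :: "real^'m::{finite,wellorder} \<Rightarrow> real^'m::_"
  assumes lin: "linear T" and det: "\<bar>det (matrix T)\<bar> = 1"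
  shows "preserves_lborel T"
proof -
  have T [measurable]: "T \<in> borel_measurable borel"
    by (simp add: lin borel_measurable_continuous_onI linear_continuous_on linear_linear)
  have "det (matrix T) \<noteq> 0" using det by auto
  then have "inj T" by (simp add: det_nz_iff_inj lin)
  then obtain S where S: "linear S" "\<And>x. S (T x) = x" "\<And>x. T (S x) = x"
    using linear_injective_isomorphism[OF lin] by blast
  have "T \<circ> S = id" using S(3) by auto
  then have "det (matrix T) * det (matrix S) = 1"
    using matrix_compose[OF S(1) lin] by (metis det_I det_mul matrix_id_mat_1)
  then have "\<bar>det (matrix T) * det (matrix S)\<bar> = 1" by simp
  then have detS: "\<bar>det (matrix S)\<bar> = 1" using det by (simp add: abs_mult)
  have "lborel = distr lborel borel T"
  proof (rule lborel_eqI)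
    fix l u :: "real^'m::_"
    assume le: "\<And>b. b \<in> Basis \<Longrightarrow> l \<bullet> b \<le> u \<bullet> b"
    have eq: "T -` box l u = S ` box l u"
    proof safe
      fix x assume "T x \<in> box l u"
      then show "x \<in> S ` box l u" by (intro image_eqI[of _ _ "T x"]) (simp_all add: S)
    qed (simp add: S)
    have meas: "S ` box l u \<in> sets borel"
      unfolding eq[symmetric] by (metis T box_borel measurable_sets_borel)
    have "emeasure (distr lborel borel T) (box l u) = emeasure lborel (S ` box l u)"
      by (simp add: emeasure_distr eq)
    also have "\<dots> = emeasure lebesgue (S ` box l u)"
      using meas by simp
    also have "\<dots> = ennreal (measure lebesgue (S ` box l u))"
      using measurable_linear_image[OF S(1), of "box l u"]
      by (simp add: emeasure_eq_measure2)
    also have "measure lebesgue (S ` box l u) = measure lebesgue (box l u)"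
      using detS by (simp add: measure_linear_image[OF S(1)])
    also have "\<dots> = (\<Prod>b\<in>Basis. (u - l) \<bullet> b)"
      using le by (simp add: measure_lborel_box_eq)
    finally show "emeasure (distr lborel borel T) (box l u) = (\<Prod>b\<in>Basis. (u - l) \<bullet> b)" .
  qed simp
  then show ?thesis by (simp add: preserves_lborel_def)
qed

lemma preserves_lborel_orthogonal:
  fixes T :: "real^'m::{finite,wellorder} \<Rightarrow> real^'m::_"
  assumes "orthogonal_transformation T"
  shows "preserves_lborel T"
  using assms by (intro preserves_lborel_linear) (auto simp: orthogonal_transformation_linear)

section \<open>Reflections and shears\<close>

definition reflect :: "real^'m \<Rightarrow> real^'m \<Rightarrow> real^'m" where
  "reflect e x = x - (2 * (e \<bullet> x)) *\<^sub>R e"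

lemma linear_reflect: "linear (reflect e)"
  by (rule linearI) (auto simp: reflect_def algebra_simps inner_add_right)

lemma reflect_reflect:
  assumes "norm e = 1" shows "reflect e (reflect e x) = x"
proof -
  have "e \<bullet> e = 1" using assms by (simp add: dot_square_norm)
  then show ?thesis by (simp add: reflect_def inner_diff_right vec_eq_iff)
qed

lemma orthogonal_reflect:
  assumes "norm e = 1" shows "orthogonal_transformation (reflect e)"
  unfolding orthogonal_transformation_def
proof (intro conjI linear_reflect allI)
  fix v w
  have "e \<bullet> e = 1" using assms by (simp add: dot_square_norm)
  then show "reflect e v \<bullet> reflect e w = v \<bullet> w"
    by (simp add: reflect_def inner_diff_left inner_diff_right inner_commute algebra_simps)
qed

lemma norm_reflect: "norm e = 1 \<Longrightarrow> norm (reflect e x) = norm x"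
  using orthogonal_reflect orthogonal_transformation_norm by blast

text \<open>No matrix is expanded: conjugating the linear part \<open>T\<close> by the reflection in
  \<open>e\<close> inverts it, so multiplicativity of the determinant gives absolute value
  1.\<close>

lemma preserves_lborel_shear:
  fixes q e :: "real^'m::{finite,wellorder}"
  assumes e: "norm e = 1" and qe: "q \<bullet> e = 0"
  shows "preserves_lborel (\<lambda>x. x + (a + q \<bullet> x) *\<^sub>R e)"
proof -
  define T where "T x = x + (q \<bullet> x) *\<^sub>R e" for x
  have lin: "linear T" unfolding T_def
    by (rule linearI) (auto simp: algebra_simps inner_add_right)
  have r: "reflect e \<circ> T \<circ> reflect e \<circ> T = id"
  proof
    fix x
    have ee: "e \<bullet> e = 1" using e by (simp add: dot_square_norm)
    have "q \<bullet> reflect e x = q \<bullet> x"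
      using qe by (simp add: reflect_def inner_diff_right)
    moreover have "reflect e (T x) = reflect e x + (- (q \<bullet> x)) *\<^sub>R e"
      using ee by (simp add: T_def reflect_def inner_add_right vec_eq_iff algebra_simps)
    ultimately have "T (reflect e (T x)) = reflect e x"
      using qe by (simp add: T_def inner_add_right inner_diff_right)
    then show "(reflect e \<circ> T \<circ> reflect e \<circ> T) x = id x"
      by (simp add: reflect_reflect e)
  qed
  have dr: "\<bar>det (matrix (reflect e))\<bar> = 1"
    using orthogonal_reflect[OF e] by simp
  have "matrix (reflect e) ** matrix T ** matrix (reflect e) ** matrix T = matrix (reflect e \<circ> T \<circ> reflect e \<circ> T)"
    by (simp add: matrix_compose linear_compose lin linear_reflect)
  then have "det (matrix (reflect e)) * det (matrix T) * det (matrix (reflect e)) * det (matrix T) = 1"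
    by (metis r det_I det_mul matrix_id_mat_1)
  then have "\<bar>det (matrix (reflect e)) * det (matrix T) * det (matrix (reflect e)) * det (matrix T)\<bar> = 1"
    by simp
  then have "\<bar>det (matrix T)\<bar> * \<bar>det (matrix T)\<bar> = 1"
    unfolding abs_mult dr by simp
  then have "\<bar>det (matrix T)\<bar>\<^sup>2 = 1\<^sup>2" by (simp add: power2_eq_square)
  then have "\<bar>det (matrix T)\<bar> = 1" by (rule power2_eq_imp_eq) auto
  then have "preserves_lborel T" using lin by (rule preserves_lborel_linear[rotated])
  then have "preserves_lborel (\<lambda>x. (+) (a *\<^sub>R e) (T x))"
    by (rule preserves_lborel_comp[OF preserves_lborel_translation])
  then show ?thesis by (simp add: T_def algebra_simps)
qed

section \<open>Radial densities\<close>

text \<open>The estimates are confined to \<open>norm x \<le> R\<close> because the hyperbolic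
  density is unbounded near the unit sphere. The bound \<open>ge_1\<close> supplies nonnegativity
  and makes every open piece inside the ball of radius \<open>R\<close> count in the volume.\<close>

locale radial_density =
  fixes f :: "real^'m::{finite,wellorder} \<Rightarrow> real" and R :: real
  assumes measurable [measurable]: "f \<in> borel_measurable borel"
    and ge_1: "norm x \<le> R \<Longrightarrow> 1 \<le> f x"
    and radial: "norm x = norm y \<Longrightarrow> f x = f y"
    and midpoint_convex: "norm x \<le> R \<Longrightarrow> norm y \<le> R \<Longrightarrow> 2 * f ((1/2) *\<^sub>R (x + y)) \<le> f x + f y"
    and bounded: "\<exists>C. \<forall>x. norm x \<le> R \<longrightarrow> f x \<le> C"
begin

definition vol :: "(real^'m::_) set \<Rightarrow> ennreal" where
  "vol S = (\<integral>\<^sup>+ x. indicator S x * ennreal (f x) \<partial>lborel)"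

lemma vol_preserves_lborel:
  assumes T: "preserves_lborel T" and S: "S \<in> sets borel"
  shows "vol S = (\<integral>\<^sup>+ x. indicator (T -` S) x * ennreal (f (T x)) \<partial>lborel)"
proof -
  have "(\<lambda>x. indicator S x * ennreal (f x)) \<in> borel_measurable borel"
    using S by measurable
  from preserves_lborel_nn_integral[OF T this] show ?thesis
    by (simp add: vol_def indicator_def)
qed

lemma vol_finite:
  assumes "S \<subseteq> cball 0 R"
  shows "vol S < \<infinity>"
proof -
  obtain C where C: "\<And>x. norm x \<le> R \<Longrightarrow> f x \<le> C" using bounded by blast
  have "vol S \<le> (\<integral>\<^sup>+ x. ennreal C * indicator (cball (0::real^'m::_) R) x \<partial>lborel)"
    unfolding vol_def
    by (rule nn_integral_mono) (use assms C in \<open>auto simp: indicator_def intro!: ennreal_leI\<close>)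
  also have "\<dots> = ennreal C * emeasure lborel (cball (0::real^'m::_) R)"
    by (rule nn_integral_cmult_indicator) simp
  also have "\<dots> < \<infinity>"
    using emeasure_lborel_cball_finite[of "0::real^'m::_" R] by (simp add: ennreal_mult_less_top)
  finally show ?thesis .
qed

lemma vol_orthogonal:
  assumes Q: "orthogonal_transformation Q" and S: "compact S"
  shows "vol (Q ` S) = vol S"
proof -
  have lin: "linear Q" using Q by (rule orthogonal_transformation_linear)
  have "compact (Q ` S)"
    using S lin by (intro compact_continuous_image) (simp_all add: linear_continuous_on linear_conv_bounded_linear)
  then have "Q ` S \<in> sets borel" by (simp add: borel_compact)
  moreover have "Q -` (Q ` S) = S"
    using orthogonal_transformation_inj[OF Q] by (rule inj_vimage_image_eq)
  moreover have "f (Q x) = f x" for x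
    by (rule radial) (rule orthogonal_transformation_norm[OF Q])
  ultimately show ?thesis
    using vol_preserves_lborel[OF preserves_lborel_orthogonal[OF Q]] by (simp add: vol_def)
qed

text \<open>As the density is at least 1, the open set \<open>U\<close> adds at least its positive
  Lebesgue measure; finiteness of \<open>vol S'\<close> makes the inequality strict.\<close>

lemma vol_strict_mono:
  assumes S: "S' \<in> sets borel" "S \<in> sets borel" "S' \<subseteq> S" "S \<subseteq> cball 0 R"
    and U: "open U" "U \<noteq> {}" "U \<subseteq> S - S'"
  shows "vol S' < vol S"
proof -
  have "vol S' < \<infinity>" using S by (intro vol_finite) auto
  have "0 < emeasure lborel U"
  proof (rule ccontr)
    assume "\<not> 0 < emeasure lborel U"
    then have "U \<in> null_sets lborel" using U by (intro null_setsI) auto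
    then have "negligible U" by (simp add: negligible_iff_null_sets null_sets_completionI)
    with U open_not_negligible show False by blast
  qed
  also have "emeasure lborel U = (\<integral>\<^sup>+ x. indicator U x \<partial>lborel)"
    using U by simp
  finally have pos: "0 < (\<integral>\<^sup>+ x. indicator U x \<partial>lborel)" .
  have "vol S' + 0 < vol S' + (\<integral>\<^sup>+ x. indicator U x \<partial>lborel)"
    using pos \<open>vol S' < \<infinity>\<close> by (intro ennreal_add_left_cancel_less[THEN iffD2]) auto
  also have "\<dots> = (\<integral>\<^sup>+ x. indicator S' x * ennreal (f x) + indicator U x \<partial>lborel)"
    unfolding vol_def using S U by (subst nn_integral_add) auto
  also have "\<dots> \<le> vol S" unfolding vol_def
  proof (rule nn_integral_mono)
    fix x
    show "indicator S' x * ennreal (f x) + indicator U x \<le> indicator S x * ennreal (f x)"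
    proof (cases "x \<in> U")
      case True
      then have "x \<in> S" "x \<notin> S'" "norm x \<le> R" using U S by auto
      then show ?thesis using True ge_1[of x] by simp
    qed (use S in \<open>auto simp: indicator_def\<close>)
  qed
  finally show ?thesis by simp
qed

text \<open>The volume of \<open>S\<close> is the integral over \<open>S'\<close> of the density at
  \<open>D x\<close>, and by symmetry of \<open>S'\<close> also that of the density at
  \<open>D (reflect e x)\<close>. Their sum dominates twice the density at \<open>x\<close> by
  midpoint convexity, so averaging gives the claim.\<close>

lemma vol_shear_symmetric:
  assumes e: "norm e = 1" and qe: "q \<bullet> e = 0"
    and sym: "\<And>x. x \<in> S' \<Longrightarrow> reflect e x \<in> S'"
    and meas: "S' \<in> sets borel" "S \<in> sets borel"
    and S: "S = (\<lambda>x. x + (a + q \<bullet> x) *\<^sub>R e) ` S'" and SR: "S \<subseteq> cball 0 R"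
  shows "vol S' \<le> vol S"
proof -
  define D where "D x = x + (a + q \<bullet> x) *\<^sub>R e" for x
  have D: "preserves_lborel D" unfolding D_def using e qe by (rule preserves_lborel_shear)
  have refl: "preserves_lborel (reflect e)"
    using orthogonal_reflect[OF e] by (rule preserves_lborel_orthogonal)
  have qD: "q \<bullet> D x = q \<bullet> x" for x using qe by (simp add: D_def inner_add_right)
  have inj: "x = y" if "D x = D y" for x y
  proof -
    have "q \<bullet> x = q \<bullet> y" using that qD by metis
    with that show ?thesis by (simp add: D_def)
  qed
  have S: "S = D ` S'" unfolding S D_def ..
  have 1: "D -` S = S'" using inj by (auto simp: S)
  have [measurable]: "D \<in> borel_measurable borel" "reflect e \<in> borel_measurable borel"
    using D refl by (auto simp: preserves_lborel_def)
  note [measurable] = meas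
  have 2: "reflect e -` S' = S'"
  proof safe
    fix x assume "reflect e x \<in> S'"
    from sym[OF this] show "x \<in> S'" by (simp add: reflect_reflect[OF e])
  qed (simp add: sym)
  have 3: "vol S = (\<integral>\<^sup>+ x. indicator S' x * ennreal (f (D x)) \<partial>lborel)"
    using vol_preserves_lborel[OF D meas(2)] by (simp add: 1)
  have 4: "vol S = (\<integral>\<^sup>+ x. indicator S' x * ennreal (f (D (reflect e x))) \<partial>lborel)"
  proof -
    have "(\<lambda>x. D (reflect e x)) -` S = reflect e -` (D -` S)" by auto
    then show ?thesis
      using vol_preserves_lborel[OF preserves_lborel_comp[OF D refl] meas(2)] by (simp add: 1 2)
  qed
  have "2 * vol S' = (\<integral>\<^sup>+ x. 2 * (indicator S' x * ennreal (f x)) \<partial>lborel)"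
    unfolding vol_def by (rule nn_integral_cmult[symmetric]) measurable
  also have "\<dots> \<le> (\<integral>\<^sup>+ x. indicator S' x * ennreal (f (D x)) + indicator S' x * ennreal (f (D (reflect e x))) \<partial>lborel)"
  proof (rule nn_integral_mono)
    fix x
    show "2 * (indicator S' x * ennreal (f x))
      \<le> indicator S' x * ennreal (f (D x)) + indicator S' x * ennreal (f (D (reflect e x)))"
    proof (cases "x \<in> S'")
      case True
      \<comment> \<open>Mirroring \<open>D (reflect e x)\<close> back does not change its density,
        and the result lies as far below \<open>x\<close> in direction \<open>e\<close> as
        \<open>D x\<close> lies above, so \<open>x\<close> is the midpoint of the two.\<close>
      let ?y = "reflect e (D (reflect e x))"
      have "D x \<in> S" "D (reflect e x) \<in> S" using True sym by (simp_all add: S)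
      then have n: "norm (D x) \<le> R" "norm (D (reflect e x)) \<le> R"
        using SR by auto
      have ny: "norm ?y = norm (D (reflect e x))" by (rule norm_reflect[OF e])
      have "q \<bullet> reflect e x = q \<bullet> x" using qe by (simp add: reflect_def inner_diff_right)
      moreover have "e \<bullet> e = 1" using e by (simp add: dot_square_norm)
      ultimately have "?y = x - (a + q \<bullet> x) *\<^sub>R e"
        by (simp add: D_def reflect_def inner_diff_right inner_add_right vec_eq_iff algebra_simps)
      then have x: "x = (1/2) *\<^sub>R (D x + ?y)" by (simp add: D_def vec_eq_iff)
      have nR: "norm x \<le> R"
      proof -
        have "norm (D x + ?y) \<le> R + R" using n ny norm_triangle_ineq[of "D x" ?y] by linarith
        then have "norm ((1/2) *\<^sub>R (D x + ?y)) \<le> R" by simp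
        with x show ?thesis by metis
      qed
      have "2 * f x \<le> f (D x) + f ?y"
        using midpoint_convex[of "D x" ?y] n ny by (simp flip: x)
      also have "f ?y = f (D (reflect e x))" using ny by (rule radial)
      finally have "ennreal (2 * f x) \<le> ennreal (f (D x) + f (D (reflect e x)))"
        by (rule ennreal_leI)
      moreover have "0 \<le> f x" "0 \<le> f (D x)" "0 \<le> f (D (reflect e x))"
        using ge_1 nR n by (force intro: order_trans[OF zero_le_one])+
      ultimately show ?thesis using True by (simp add: ennreal_mult')
    qed simp
  qed
  also have "\<dots> = vol S + vol S"
    unfolding 3 by (subst nn_integral_add) (auto simp: 3[symmetric] 4[symmetric])
  finally have "2 * vol S' \<le> 2 * vol S" by (simp add: mult_2)
  then show ?thesis by (subst (asm) ennreal_mult_le_mult_iff) auto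
qed

text \<open>Fatou's lemma. The frontier of a convex set is null, so convergence is asked for only at
  interior points. Lower semicontinuity is the form of continuity that a minimising sequence calls
  for.\<close>

lemma vol_liminf:
  assumes S: "convex S" "compact S" and X: "\<And>n. X n \<in> sets borel"
    and ev: "\<And>x. x \<in> interior S \<Longrightarrow> eventually (\<lambda>n. x \<in> X n) sequentially"
  shows "vol S \<le> liminf (\<lambda>n. vol (X n))"
proof -
  note [measurable] = X
  have "negligible (frontier S)" using S(1) by (rule negligible_convex_frontier)
  moreover have "closed (frontier S)" by (rule frontier_closed)
  ultimately have "frontier S \<in> null_sets lborel"
    by (simp add: negligible_iff_null_sets null_sets_completion_iff)
  then have "AE x in lborel. x \<notin> frontier S" by (rule AE_not_in)
  then have "vol S \<le> (\<integral>\<^sup>+ x. liminf (\<lambda>n. indicator (X n) x * ennreal (f x)) \<partial>lborel)"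
    unfolding vol_def
  proof (intro nn_integral_mono_AE, eventually_elim)
    fix x assume x: "x \<notin> frontier S"
    show "indicator S x * ennreal (f x) \<le> liminf (\<lambda>n. indicator (X n) x * ennreal (f x))"
    proof (cases "x \<in> S")
      case True
      then have "x \<in> interior S" using x closure_subset[of S] by (auto simp: frontier_def)
      from ev[OF this] have "eventually (\<lambda>n. ennreal (f x) \<le> indicator (X n) x * ennreal (f x)) sequentially"
        by eventually_elim simp
      then show ?thesis using True by (simp add: Liminf_bounded)
    qed simp
  qed
  also have "\<dots> \<le> liminf (\<lambda>n. vol (X n))"
    unfolding vol_def by (rule nn_integral_liminf) measurable
  finally show ?thesis .
qed

end

section \<open>Existence of minimisers\<close>

lemma separating_point_convex_hull:
  fixes v :: "'k::finite \<Rightarrow> real^'n"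
  assumes "x \<notin> convex hull (range v)"
  obtains a where "\<And>k. a \<bullet> x < a \<bullet> v k"
proof -
  have "closed (convex hull (range v))"
    by (simp add: compact_imp_closed finite_imp_compact_convex_hull)
  from separating_hyperplane_closed_point[OF convex_convex_hull this assms]
  obtain a b where ab: "a \<bullet> x < b" "\<forall>y\<in>convex hull (range v). a \<bullet> y > b" by blast
  have "a \<bullet> x < a \<bullet> v k" for k
    using ab hull_inc[of "v k" "range v" convex] by force
  then show ?thesis using that by blast
qed

lemma convex_hull_range_inner_le:
  fixes v :: "'k::finite \<Rightarrow> real^'n"
  assumes "y \<in> convex hull (range v)"
  obtains k where "u \<bullet> y \<le> u \<bullet> v k"
proof (rule ccontr)
  assume "\<not> thesis"
  then have "range v \<subseteq> {z. u \<bullet> z < u \<bullet> y}" by (auto simp: not_le[symmetric] intro: that)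
  then have "convex hull (range v) \<subseteq> {z. u \<bullet> z < u \<bullet> y}"
    by (rule hull_minimal) (rule convex_halfspace_lt)
  with assms show False by auto
qed

text \<open>Containment of convex bodies as an inequality of support functions. Unlike the
  barycentric criterion this presupposes no nondegeneracy and is visibly a closed condition on the
  vertices.\<close>

lemma cball_subset_hull_iff_support:
  fixes v :: "'k::finite \<Rightarrow> real^'n"
  assumes "0 \<le> \<rho>"
  shows "cball 0 \<rho> \<subseteq> convex hull (range v) \<longleftrightarrow> (\<forall>u. \<exists>k. \<rho> * norm u \<le> u \<bullet> v k)"
proof
  assume L: "cball 0 \<rho> \<subseteq> convex hull (range v)"
  show "\<forall>u. \<exists>k. \<rho> * norm u \<le> u \<bullet> v k"
  proof
    fix u
    have "\<rho> *\<^sub>R sgn u \<in> convex hull (range v)"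
      using L assms by (auto simp: norm_sgn)
    then obtain k where "u \<bullet> (\<rho> *\<^sub>R sgn u) \<le> u \<bullet> v k" by (rule convex_hull_range_inner_le)
    then show "\<exists>k. \<rho> * norm u \<le> u \<bullet> v k" by (auto simp: inner_sgn_self)
  qed
next
  assume R: "\<forall>u. \<exists>k. \<rho> * norm u \<le> u \<bullet> v k"
  show "cball 0 \<rho> \<subseteq> convex hull (range v)"
  proof (rule subsetI, rule ccontr)
    fix x assume x: "x \<in> cball 0 \<rho>" "x \<notin> convex hull (range v)"
    from x(2) obtain a where a: "\<And>k. a \<bullet> x < a \<bullet> v k" by (rule separating_point_convex_hull) blast
    obtain k where "\<rho> * norm (-a) \<le> (-a) \<bullet> v k" using R by blast
    with a[of k] have "\<rho> * norm a < - (a \<bullet> x)" by simp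
    also have "\<dots> \<le> norm a * norm x" by (metis Cauchy_Schwarz_ineq2 abs_le_D2)
    also have "\<dots> \<le> norm a * \<rho>" using x(1) by (simp add: mult_left_mono)
    finally show False by (simp add: mult.commute)
  qed
qed

text \<open>If \<open>x\<close> left the hull, a direction \<open>a\<close> would separate it from
  all \<open>w k\<close>. Yet the hull of the \<open>v k\<close> reaches \<epsilon> beyond
  \<open>x\<close> against \<open>a\<close>, and some \<open>w k\<close> stays closer than
  \<epsilon> to a vertex at least as far out.\<close>

lemma interior_convex_hull_stable:
  fixes v :: "'k::finite \<Rightarrow> real^'n"
  assumes "x \<in> interior (convex hull (range v))"
  obtains \<epsilon> where "\<epsilon> > 0" "\<And>w. (\<And>k. dist (w k) (v k) < \<epsilon>) \<Longrightarrow> x \<in> convex hull (range w)"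
proof -
  obtain \<epsilon> where \<epsilon>: "\<epsilon> > 0" "cball x \<epsilon> \<subseteq> convex hull (range v)"
    using assms by (auto simp: mem_interior_cball)
  have "x \<in> convex hull (range w)" if w: "\<And>k. dist (w k) (v k) < \<epsilon>" for w
  proof (rule ccontr)
    assume "x \<notin> convex hull (range w)"
    then obtain a where a: "\<And>k. a \<bullet> x < a \<bullet> w k" by (rule separating_point_convex_hull) blast
    have "x - \<epsilon> *\<^sub>R sgn a \<in> cball x \<epsilon>" using \<epsilon>(1) by (simp add: dist_norm norm_sgn)
    then have "x - \<epsilon> *\<^sub>R sgn a \<in> convex hull (range v)" using \<epsilon>(2) by blast
    then obtain k where "(-a) \<bullet> (x - \<epsilon> *\<^sub>R sgn a) \<le> (-a) \<bullet> v k"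
      by (rule convex_hull_range_inner_le)
    then have "a \<bullet> v k \<le> a \<bullet> x - \<epsilon> * norm a"
      by (simp add: inner_diff_right inner_sgn_self)
    with a[of k] have "\<epsilon> * norm a < a \<bullet> (w k - v k)" by (simp add: inner_diff_right)
    also have "\<dots> \<le> norm a * norm (w k - v k)" by (rule norm_cauchy_schwarz)
    also have "\<dots> \<le> norm a * \<epsilon>" using w[of k] by (intro mult_left_mono) (auto simp: dist_norm)
    finally show False by (simp add: mult.commute)
  qed
  with \<epsilon>(1) show ?thesis using that by blast
qed

context radial_density
begin

text \<open>Families rather than vertex sets, so that limits can be taken in a product space. The
  cap \<open>R\<close> gives compactness; a ball of positive radius inside the hull excludes
  degenerate limits.\<close>

definition admissible :: "real \<Rightarrow> ('m::_ option \<Rightarrow> real^'m::_) \<Rightarrow> bool" where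
  "admissible \<rho> v \<longleftrightarrow> (\<forall>k. norm (v k) \<le> R) \<and> cball 0 \<rho> \<subseteq> convex hull (range v)"

definition minimizer :: "real \<Rightarrow> ('m::_ option \<Rightarrow> real^'m::_) \<Rightarrow> bool" where
  "minimizer \<rho> v \<longleftrightarrow> admissible \<rho> v \<and>
     (\<forall>w. admissible \<rho> w \<longrightarrow> vol (convex hull (range v)) \<le> vol (convex hull (range w)))"

lemma hull_subset_cball: "admissible \<rho> v \<Longrightarrow> convex hull (range v) \<subseteq> cball 0 R"
  unfolding admissible_def by (intro hull_minimal) auto

lemma borel_hull [measurable]: "convex hull (range (v :: 'm option \<Rightarrow> real^'m::_)) \<in> sets borel"
  by (intro borel_compact finite_imp_compact_convex_hull) simp

lemma dual_system_of_admissible: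
  assumes "admissible \<rho> v" "\<rho> > 0"
  shows "\<exists>\<alpha> p. dual_system v \<alpha> p"
  using assms cball_interior_nonempty[of \<rho> "convex hull (range v)"]
  by (intro dual_system_exists) (auto simp: admissible_def)

lemma minimizer_exists:
  assumes w: "admissible \<rho> w" and \<rho>: "\<rho> > 0"
  shows "\<exists>u. minimizer \<rho> u"
proof -
  define K :: "((real^'m::_)^'m option) set" where "K = {t. admissible \<rho> (\<lambda>k. t $ k)}"
  define g where "g t = vol (convex hull (range (\<lambda>k. t $ k)))" for t :: "(real^'m::_)^'m option"
  \<comment> \<open>Closedness becomes visible: the second part intersects, over all directions
    \<open>u\<close>, finite unions of closed half-space conditions.\<close>
  have K_eq: "K = (\<Inter>k. {t. norm (t $ k) \<le> R}) \<inter> (\<Inter>u. \<Union>k. {t. \<rho> * norm u \<le> u \<bullet> t $ k})"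
    using \<rho> by (auto simp: K_def admissible_def cball_subset_hull_iff_support)
  have "closed K"
    unfolding K_eq
    by (intro closed_Int closed_INT closed_UN ballI closed_Collect_le continuous_intros) auto
  moreover have "bounded K"
  proof -
    have "norm t \<le> (\<Sum>k\<in>(UNIV::'m option set). R)" if "t \<in> K" for t
    proof -
      have "norm t \<le> (\<Sum>k\<in>UNIV. norm (t $ k))"
        unfolding norm_vec_def by (rule L2_set_le_sum) simp
      also have "\<dots> \<le> (\<Sum>k\<in>(UNIV::'m option set). R)"
        using that by (intro sum_mono) (auto simp: K_def admissible_def)
      finally show ?thesis .
    qed
    then show ?thesis unfolding bounded_iff by blast
  qed
  ultimately have "compact K" by (simp add: compact_eq_bounded_closed)
  have nth_lambda: "($) (\<chi> k. y k) = y" for y :: "'m option \<Rightarrow> real^'m::_"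
    by (simp add: fun_eq_iff)
  have "(\<chi> k. w k) \<in> K" using w by (simp add: K_def nth_lambda)
  then have "g ` K \<noteq> {}" by blast
  from Inf_as_limit[OF this] obtain U where U: "\<forall>n. U n \<in> g ` K" "U \<longlonglongrightarrow> Inf (g ` K)"
    by (elim exE conjE)
  from U(1) have "\<forall>n. \<exists>t. t \<in> K \<and> U n = g t" by blast
  then obtain T where T: "\<And>n. T n \<in> K" "\<And>n. U n = g (T n)" by metis
  obtain l r where l: "l \<in> K" "strict_mono r" "(T \<circ> r) \<longlonglongrightarrow> l"
    using \<open>compact K\<close> T(1) unfolding compact_def by metis
  have "g l \<le> liminf (\<lambda>n. g (T (r n)))"
    unfolding g_def
  proof (rule vol_liminf)
    fix x assume "x \<in> interior (convex hull range (($) l))"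
    then obtain \<epsilon> where \<epsilon>: "\<epsilon> > 0"
      "\<And>w. (\<And>k. dist (w k) (l $ k) < \<epsilon>) \<Longrightarrow> x \<in> convex hull (range w)"
      by (rule interior_convex_hull_stable) blast
    have "eventually (\<lambda>n. dist (T (r n)) l < \<epsilon>) sequentially"
      using l(3) \<epsilon>(1) by (auto simp: tendsto_iff comp_def)
    then show "eventually (\<lambda>n. x \<in> convex hull range (($) (T (r n)))) sequentially"
    proof eventually_elim
      case (elim n)
      show ?case
      proof (rule \<epsilon>(2))
        fix k show "dist (T (r n) $ k) (l $ k) < \<epsilon>"
          using elim dist_vec_nth_le[of "T (r n)" k l] by linarith
      qed
    qed
  qed (auto intro: convex_convex_hull finite_imp_compact_convex_hull)
  also have "(\<lambda>n. g (T (r n))) \<longlonglongrightarrow> Inf (g ` K)"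
    using LIMSEQ_subseq_LIMSEQ[OF U(2) l(2)] by (simp add: comp_def T(2))
  then have "liminf (\<lambda>n. g (T (r n))) = Inf (g ` K)"
    by (rule lim_imp_Liminf[rotated]) simp
  finally have gl: "g l \<le> Inf (g ` K)" .
  have "minimizer \<rho> (\<lambda>k. l $ k)"
    unfolding minimizer_def
  proof (intro conjI allI impI)
    show "admissible \<rho> (($) l)" using l(1) by (simp add: K_def)
    fix y assume "admissible \<rho> y"
    then have "(\<chi> k. y k) \<in> K" by (simp add: K_def nth_lambda)
    then have "Inf (g ` K) \<le> g (\<chi> k. y k)" by (intro Inf_lower) simp
    with gl have "g l \<le> g (\<chi> k. y k)" by (rule order_trans)
    then show "vol (convex hull range (($) l)) \<le> vol (convex hull range y)"
      by (simp add: g_def nth_lambda)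
  qed
  then show ?thesis by blast
qed

end

section \<open>Symmetrisation\<close>

context radial_density
begin

text \<open>Otherwise the simplex is shrunk by a homothety centred at \<open>v i\<close>. This keeps
  the planes of all facets through \<open>v i\<close> and moves the opposite facet inwards by
  exactly the available slack.\<close>

lemma minimizer_touches:
  assumes min: "minimizer \<rho> v" and \<rho>: "\<rho> > 0" and dual: "dual_system v \<alpha> p"
  shows "\<alpha> i = \<rho> * norm (p i)"
proof (rule ccontr)
  assume ne: "\<alpha> i \<noteq> \<rho> * norm (p i)"
  have adm: "admissible \<rho> v" using min by (simp add: minimizer_def)
  have le: "\<rho> * norm (p k) \<le> \<alpha> k" for k
    using adm \<rho> dual_system_cball[OF dual, of \<rho>] by (simp add: admissible_def)
  have \<alpha>0: "0 \<le> \<alpha> k" for k using le[of k] \<rho> by (smt (verit) mult_nonneg_nonneg norm_ge_zero)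
  \<comment> \<open>The numbers \<open>\<alpha> k\<close> are the barycentric coordinates of the
    origin.\<close>
  have "(\<Sum>k\<in>UNIV. \<alpha> k) = 1" using dual_system_decomp(1)[OF dual, of 0] by simp
  then have \<alpha>1: "\<alpha> i \<le> 1" using member_le_sum[of i UNIV \<alpha>] \<alpha>0 by simp
  obtain j where ji: "j \<noteq> i" by (metis option.distinct(1))
  have "p i \<noteq> 0"
  proof
    assume "p i = 0"
    then show False using dual_systemD[OF dual, of i i] dual_systemD[OF dual, of i j] ji by simp
  qed
  \<comment> \<open>This is the minimum of the i-th coordinate on the ball. The homothety of ratio
    \<open>1 - \<epsilon>\<close> puts the new facet where that coordinate equals \<epsilon>, so the
    ball just stays inside.\<close>
  define \<epsilon> where "\<epsilon> = \<alpha> i - \<rho> * norm (p i)"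
  have \<epsilon>: "0 < \<epsilon>" "\<epsilon> < 1"
    using ne le[of i] \<alpha>1 \<rho> \<open>p i \<noteq> 0\<close> by (auto simp: \<epsilon>_def) (smt (verit) mult_pos_pos zero_less_norm_iff)
  define w where "w k = \<epsilon> *\<^sub>R v i + (1 - \<epsilon>) *\<^sub>R v k" for k
  define \<beta> where "\<beta> k = (if k = i then (\<alpha> k - \<epsilon>) / (1 - \<epsilon>) else \<alpha> k / (1 - \<epsilon>))" for k
  define s where "s k = (1 / (1 - \<epsilon>)) *\<^sub>R p k" for k
  have lam_w: "\<alpha> k + p k \<bullet> w l = \<epsilon> * (if k = i then 1 else 0) + (1 - \<epsilon>) * (if k = l then 1 else 0)" for k l
  proof -
    have "\<alpha> k + p k \<bullet> w l = \<epsilon> * (\<alpha> k + p k \<bullet> v i) + (1 - \<epsilon>) * (\<alpha> k + p k \<bullet> v l)"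
      by (simp add: w_def inner_add_right algebra_simps)
    then show ?thesis by (simp add: dual_systemD[OF dual])
  qed
  have lam_s: "\<beta> k + s k \<bullet> x = (\<alpha> k + p k \<bullet> x - (if k = i then \<epsilon> else 0)) / (1 - \<epsilon>)" for k x
    using \<epsilon> by (simp add: \<beta>_def s_def field_simps)
  have dual': "dual_system w \<beta> s"
    using \<epsilon> unfolding dual_system_def lam_s lam_w by auto
  have hull_w: "convex hull (range w) = {x. \<forall>k. (if k = i then \<epsilon> else 0) \<le> \<alpha> k + p k \<bullet> x}"
    unfolding dual_system_hull[OF dual'] lam_s using \<epsilon> by (auto simp: zero_le_divide_iff)
  have "cball 0 \<rho> \<subseteq> convex hull (range w)"
  proof (subst dual_system_cball[OF dual'])
    have "\<rho> * norm (p k) + (if k = i then \<epsilon> else 0) \<le> \<alpha> k" for k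
      using le[of k] by (simp add: \<epsilon>_def)
    then have "\<rho> * norm (p k) / (1 - \<epsilon>) \<le> (\<alpha> k - (if k = i then \<epsilon> else 0)) / (1 - \<epsilon>)" for k
      using \<epsilon> by (intro divide_right_mono) (auto simp: algebra_simps)
    then show "\<forall>k. \<rho> * norm (s k) \<le> \<beta> k"
      using \<epsilon> lam_s[of _ 0] by (simp add: s_def)
  qed (use \<rho> in simp)
  moreover have "norm (w k) \<le> R" for k
  proof -
    have "w k \<in> convex hull (range v)"
      unfolding w_def using \<epsilon> by (intro convexD[OF convex_convex_hull]) (auto intro: hull_inc)
    then show ?thesis using hull_subset_cball[OF adm] by auto
  qed
  ultimately have adm_w: "admissible \<rho> w" by (simp add: admissible_def)
  \<comment> \<open>The open part of the slab cut off between the old facet and the new one. It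
    contains the point whose i-th coordinate is \<open>\<epsilon>/2\<close> and whose other
    coordinates share the rest equally.\<close>
  define U where "U = {x. \<alpha> i + p i \<bullet> x < \<epsilon>} \<inter> (\<Inter>k. {x. 0 < \<alpha> k + p k \<bullet> x})"
  have "open U" unfolding U_def
    by (intro open_Int open_INT ballI open_Collect_less continuous_intros) auto
  moreover have "U \<noteq> {}"
  proof -
    define c where "c l = (if l = i then \<epsilon>/2 else (1 - \<epsilon>/2) / real CARD('m))" for l :: "'m option"
    have "(\<Sum>l\<in>UNIV. c l) = c i + (\<Sum>l\<in>UNIV - {i}. c l)"
      by (simp add: sum.remove[of UNIV i])
    also have "(\<Sum>l\<in>UNIV - {i}. c l) = (\<Sum>l\<in>UNIV - {i}. (1 - \<epsilon>/2) / real CARD('m))"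
      by (intro sum.cong) (auto simp: c_def)
    also have "\<dots> = 1 - \<epsilon>/2" by (simp add: card_Diff_singleton card_UNIV_option)
    finally have "(\<Sum>l\<in>UNIV. c l) = 1" by (simp add: c_def)
    note c = dual_system_combination[OF dual this]
    have "0 < c k" "c i < \<epsilon>" for k using \<epsilon> by (simp_all add: c_def)
    then have "(\<Sum>l\<in>UNIV. c l *\<^sub>R v l) \<in> U" by (simp add: U_def c)
    then show ?thesis by blast
  qed
  moreover have "U \<subseteq> convex hull (range v) - convex hull (range w)"
    unfolding U_def hull_w dual_system_hull[OF dual] by (auto intro: less_imp_le)
  moreover have "convex hull (range w) \<subseteq> convex hull (range v)"
    unfolding hull_w dual_system_hull[OF dual]
  proof safe
    fix x k assume "\<forall>k. (if k = i then \<epsilon> else 0) \<le> \<alpha> k + p k \<bullet> x"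
    from this[rule_format, of k] show "0 \<le> \<alpha> k + p k \<bullet> x"
      using \<epsilon> by (auto split: if_splits)
  qed
  ultimately have "vol (convex hull (range w)) < vol (convex hull (range v))"
    by (intro vol_strict_mono hull_subset_cball[OF adm] borel_hull) auto
  with min adm_w show False by (auto simp: minimizer_def)
qed

text \<open>Steiner symmetrisation parallel to the edge is here a shear, so a simplex results. The
  facets meeting the edge in one end get normals averaged with a mirrored normal, and the triangle
  inequality keeps the ball inside; all other normals are orthogonal to \<open>e\<close> and
  unchanged. The returned data concern the facet opposite vertex \<open>i\<close>, where equality
  will be examined.\<close>

lemma symmetrization:
  assumes adm: "admissible \<rho> v" and \<rho>: "\<rho> > 0" and dual: "dual_system v \<alpha> p" and ij: "i \<noteq> j"
  defines "e \<equiv> sgn (v i - v j)"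
  obtains w \<beta> s where "admissible \<rho> w" "vol (convex hull (range w)) \<le> vol (convex hull (range v))"
    "dual_system w \<beta> s" "\<beta> i = (\<alpha> i + \<alpha> j) / 2" "s i = (1/2) *\<^sub>R (p i + reflect e (p j))"
proof -
  define \<delta> where "\<delta> = norm (v i - v j)"
  have "v i \<noteq> v j" using dual_system_inj[OF dual] ij by (auto dest: injD)
  then have \<delta>: "\<delta> > 0" by (simp add: \<delta>_def)
  have e: "norm e = 1" using \<open>v i \<noteq> v j\<close> by (simp add: e_def norm_sgn)
  then have ee: "e \<bullet> e = 1" by (simp add: dot_square_norm)
  have vij: "v i = v j + \<delta> *\<^sub>R e"
    using \<open>v i \<noteq> v j\<close> by (simp add: e_def \<delta>_def sgn_div_norm)
  \<comment> \<open>Along the edge only the coordinates of its two ends vary, with opposite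
    slopes.\<close>
  have pe: "p k \<bullet> e = ((if k = i then 1 else 0) - (if k = j then 1 else 0)) / \<delta>" for k
  proof -
    have "p k \<bullet> v i = p k \<bullet> v j + \<delta> * (p k \<bullet> e)" by (simp add: vij inner_add_right)
    then have "\<delta> * (p k \<bullet> e) = (\<alpha> k + p k \<bullet> v i) - (\<alpha> k + p k \<bullet> v j)" by simp
    then show ?thesis using \<delta> by (simp add: dual_systemD[OF dual] field_simps)
  qed
  \<comment> \<open>The height of the edge's midpoint over the mirror hyperplane. Removing \<mu>
    from both ends centres the edge; every other vertex is dropped onto the hyperplane.\<close>
  define \<mu> where "\<mu> = e \<bullet> v j + \<delta> / 2"
  define m where "m k = (if k = i \<or> k = j then \<mu> else e \<bullet> v k)" for k
  define w where "w k = v k - m k *\<^sub>R e" for k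
  define \<beta> where "\<beta> k = (if k = i \<or> k = j then (\<alpha> i + \<alpha> j) / 2 else \<alpha> k)" for k
  \<comment> \<open>The sum of the i-th and j-th coordinates is constant along \<open>e\<close> and
    survives; symmetry forces equal halves of it plus or minus the height over the hyperplane
    divided by \<delta>.\<close>
  define s where "s k = (if k = i then (1/2) *\<^sub>R (p i + p j) + (1/\<delta>) *\<^sub>R e
      else if k = j then (1/2) *\<^sub>R (p i + p j) - (1/\<delta>) *\<^sub>R e else p k)" for k
  have evi: "e \<bullet> v i = e \<bullet> v j + \<delta>" by (simp add: vij inner_add_right ee)
  have dual': "dual_system w \<beta> s"
    unfolding dual_system_def
  proof (intro allI)
    fix k l
    have pp: "(p i + p j) \<bullet> e = 0" using ij by (simp add: inner_add_left pe)
    have ew: "e \<bullet> w l = (if l = i then \<delta>/2 else if l = j then - (\<delta>/2) else 0)"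
      by (simp add: w_def m_def inner_diff_right ee evi \<mu>_def)
    have ppw: "(p i + p j) \<bullet> w l = (if l = i \<or> l = j then 1 else 0) - \<alpha> i - \<alpha> j"
    proof -
      have "(p i + p j) \<bullet> w l = (p i + p j) \<bullet> v l" using pp by (simp add: w_def inner_diff_right)
      then show ?thesis
        using dual_systemD[OF dual, of i l] dual_systemD[OF dual, of j l] ij
        by (auto simp: inner_add_left split: if_splits)
    qed
    consider "k = i" | "k = j" | "k \<noteq> i" "k \<noteq> j" by blast
    then show "\<beta> k + s k \<bullet> w l = (if k = l then 1 else 0)"
    proof cases
      case 1
      then have eq: "\<beta> k + s k \<bullet> w l = (\<alpha> i + \<alpha> j)/2 + (1/2) * ((p i + p j) \<bullet> w l) + (1/\<delta>) * (e \<bullet> w l)"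
        by (simp add: \<beta>_def s_def inner_add_left)
      show ?thesis unfolding eq ppw ew using 1 ij \<delta> by (cases "l = i"; cases "l = j") (auto simp: field_simps)
    next
      case 2
      then have eq: "\<beta> k + s k \<bullet> w l = (\<alpha> i + \<alpha> j)/2 + (1/2) * ((p i + p j) \<bullet> w l) - (1/\<delta>) * (e \<bullet> w l)"
        using ij by (simp add: \<beta>_def s_def inner_add_left inner_diff_left)
      show ?thesis unfolding eq ppw ew using 2 ij \<delta> by (cases "l = i"; cases "l = j") (auto simp: field_simps)
    next
      case 3
      then have "\<beta> k + s k \<bullet> w l = \<alpha> k + p k \<bullet> v l"
        by (simp add: \<beta>_def s_def w_def inner_diff_right pe)
      then show ?thesis by (simp add: dual_systemD[OF dual])
    qed
  qed
  have si: "s i = (1/2) *\<^sub>R (p i + reflect e (p j))"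
  proof -
    have "e \<bullet> p j = - 1 / \<delta>" using pe[of j] ij by (simp add: inner_commute)
    then show ?thesis by (simp add: s_def reflect_def vec_eq_iff algebra_simps)
  qed
  have sj: "s j = (1/2) *\<^sub>R (p j + reflect e (p i))"
  proof -
    have "e \<bullet> p i = 1 / \<delta>" using pe[of i] ij by (simp add: inner_commute)
    then show ?thesis using ij by (simp add: s_def reflect_def vec_eq_iff algebra_simps)
  qed
  have refl_w: "reflect e (w k) \<in> range w" for k
  proof -
    have "reflect e (w i) = w j" using ij
      by (simp add: reflect_def w_def m_def inner_diff_right ee evi \<mu>_def vij vec_eq_iff algebra_simps)
    moreover have "reflect e (w j) = w i" using ij
      by (simp add: reflect_def w_def m_def inner_diff_right ee evi \<mu>_def vij vec_eq_iff algebra_simps)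
    moreover have "reflect e (w k) = w k" if "k \<noteq> i" "k \<noteq> j"
      using that by (simp add: reflect_def w_def m_def inner_diff_right ee)
    ultimately show ?thesis by (metis rangeI)
  qed
  have sym: "reflect e x \<in> convex hull (range w)" if "x \<in> convex hull (range w)" for x
  proof -
    have "reflect e x \<in> reflect e ` (convex hull (range w))" using that by blast
    also have "\<dots> = convex hull (reflect e ` range w)"
      by (rule convex_hull_linear_image[OF linear_reflect])
    also have "\<dots> \<subseteq> convex hull (range w)" by (intro hull_mono) (auto simp: refl_w)
    finally show ?thesis .
  qed
  have nv: "norm (v k) \<le> R" for k using adm by (simp add: admissible_def)
  \<comment> \<open>Each new vertex is the midpoint of an old vertex and a mirrored old vertex, so
    the cap \<open>R\<close> is respected.\<close>
  have nw: "norm (w k) \<le> R" for k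
  proof -
    have avg: "norm ((1/2) *\<^sub>R (v k + reflect e (v l))) \<le> R" for k l
      using norm_triangle_ineq[of "v k" "reflect e (v l)"] norm_reflect[OF e, of "v l"] nv[of k] nv[of l]
      by simp
    have "w i = (1/2) *\<^sub>R (v i + reflect e (v j))"
      using ij by (simp add: reflect_def w_def m_def \<mu>_def vij vec_eq_iff algebra_simps)
    moreover have "w j = (1/2) *\<^sub>R (v j + reflect e (v i))"
      using ij by (simp add: reflect_def w_def m_def \<mu>_def vij inner_add_right ee vec_eq_iff algebra_simps)
    moreover have "w k = (1/2) *\<^sub>R (v k + reflect e (v k))" if "k \<noteq> i" "k \<noteq> j"
      using that by (simp add: reflect_def w_def m_def vec_eq_iff algebra_simps)
    ultimately show ?thesis using avg by metis
  qed
  have le: "\<rho> * norm (p k) \<le> \<alpha> k" for k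
    using adm \<rho> dual_system_cball[OF dual, of \<rho>] by (simp add: admissible_def)
  have ns: "\<rho> * norm ((1/2) *\<^sub>R (p k + reflect e (p l))) \<le> (\<alpha> k + \<alpha> l) / 2" for k l
  proof -
    have "\<rho> * norm (p k + reflect e (p l)) \<le> \<rho> * (norm (p k) + norm (p l))"
      using \<rho> norm_triangle_ineq[of "p k" "reflect e (p l)"] norm_reflect[OF e, of "p l"]
      by (intro mult_left_mono) auto
    then show ?thesis using le[of k] le[of l] by (simp add: distrib_left)
  qed
  have "cball 0 \<rho> \<subseteq> convex hull (range w)"
    unfolding dual_system_cball[OF dual' less_imp_le[OF \<rho>]]
  proof
    fix k
    show "\<rho> * norm (s k) \<le> \<beta> k"
      using ns[of i j] ns[of j i] si sj le[of k] by (cases "k = i"; cases "k = j") (auto simp: \<beta>_def s_def[of k])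
  qed
  with nw have adm_w: "admissible \<rho> w" by (simp add: admissible_def)
  \<comment> \<open>The affine function \<open>a + q \<bullet> x\<close> interpolates the
    displacements \<open>m l\<close> at the vertices \<open>w l\<close>, so adding it in direction
    \<open>e\<close> is the shear back to the original simplex.\<close>
  define a where "a = (\<Sum>k\<in>UNIV. m k * \<beta> k)"
  define q where "q = (\<Sum>k\<in>UNIV. m k *\<^sub>R s k)"
  have aq: "a + q \<bullet> x = (\<Sum>k\<in>UNIV. m k * (\<beta> k + s k \<bullet> x))" for x
    by (simp add: a_def q_def inner_sum_left sum.distrib distrib_left)
  \<comment> \<open>The slopes of the i-th and j-th coordinates along \<open>e\<close> cancel
    because both ends of the edge are displaced by the same \<mu>.\<close>
  have qe: "q \<bullet> e = 0"
  proof -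
    have se: "s k \<bullet> e = ((if k = i then 1 else 0) - (if k = j then 1 else 0)) / \<delta>" for k
      using ij by (simp add: s_def inner_add_left inner_diff_left pe ee)
    have "q \<bullet> e = (\<Sum>k\<in>UNIV. m k * (s k \<bullet> e))" by (simp add: q_def inner_sum_left)
    also have "\<dots> = (\<Sum>k\<in>UNIV. (if k = i then \<mu>/\<delta> else 0) - (if k = j then \<mu>/\<delta> else 0))"
      by (intro sum.cong) (auto simp: se m_def)
    finally show ?thesis by (simp add: sum_subtractf)
  qed
  have aqw: "a + q \<bullet> w l = m l" for l
    unfolding aq dual_systemD[OF dual'] by (simp add: if_distrib[of "(*) _"] cong: if_cong)
  have "convex hull (range v) = (\<lambda>x. x + (a + q \<bullet> x) *\<^sub>R e) ` (convex hull (range w))"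
  proof -
    define L where "L x = x + (q \<bullet> x) *\<^sub>R e" for x
    have lin: "linear L" unfolding L_def by (rule linearI) (auto simp: algebra_simps inner_add_right)
    have v: "v k = a *\<^sub>R e + L (w k)" for k
    proof -
      have "v k = w k + m k *\<^sub>R e" by (simp add: w_def)
      also have "\<dots> = w k + (a + q \<bullet> w k) *\<^sub>R e" by (simp add: aqw)
      finally show ?thesis by (simp add: L_def algebra_simps)
    qed
    have "range v = (+) (a *\<^sub>R e) ` (L ` range w)" by (simp add: v image_image)
    then have "convex hull (range v) = (+) (a *\<^sub>R e) ` (L ` (convex hull (range w)))"
      by (simp add: convex_hull_translation convex_hull_linear_image[OF lin])
    then show ?thesis by (simp add: image_image L_def algebra_simps)
  qed
  from vol_shear_symmetric[OF e qe sym borel_hull borel_hull this hull_subset_cball[OF adm]]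
  have "vol (convex hull (range w)) \<le> vol (convex hull (range v))" .
  from that[OF adm_w this dual' _ si] show thesis by (simp add: \<beta>_def)
qed

text \<open>Touching, for the old and the symmetrised simplex, turns the triangle inequality for
  \<open>p i\<close> and the mirrored \<open>p j\<close> into an equality, so they are parallel.
  Their equal nonzero components along \<open>e\<close> fix the remaining scale.\<close>

lemma minimizer_reflect:
  assumes min: "minimizer \<rho> v" and \<rho>: "\<rho> > 0" and dual: "dual_system v \<alpha> p" and ij: "i \<noteq> j"
  shows "p i = reflect (sgn (v i - v j)) (p j)" "\<alpha> i = \<alpha> j"
proof -
  define e where "e = sgn (v i - v j)"
  have "v i \<noteq> v j" using dual_system_inj[OF dual] ij by (auto dest: injD)
  then have e: "norm e = 1" by (simp add: e_def norm_sgn)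
  then have ee: "e \<bullet> e = 1" by (simp add: dot_square_norm)
  have adm: "admissible \<rho> v" using min by (simp add: minimizer_def)
  from symmetrization[OF adm \<rho> dual ij, folded e_def]
  obtain w \<beta> s where w: "admissible \<rho> w" "vol (convex hull (range w)) \<le> vol (convex hull (range v))"
    "dual_system w \<beta> s" "\<beta> i = (\<alpha> i + \<alpha> j) / 2" "s i = (1/2) *\<^sub>R (p i + reflect e (p j))" .
  have "minimizer \<rho> w" using min w(1,2) by (auto simp: minimizer_def intro: order_trans)
  from minimizer_touches[OF this \<rho> w(3), of i]
  have "\<rho> * norm (p i + reflect e (p j)) = \<alpha> i + \<alpha> j" by (simp add: w)
  also have "\<dots> = \<rho> * (norm (p i) + norm (p j))"
    by (simp add: minimizer_touches[OF min \<rho> dual] distrib_left)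
  finally have "norm (p i + reflect e (p j)) = norm (p i) + norm (reflect e (p j))"
    using \<rho> by (simp add: norm_reflect[OF e])
  then have par: "norm (p i) *\<^sub>R reflect e (p j) = norm (p j) *\<^sub>R p i"
    using norm_triangle_eq[of "p i" "reflect e (p j)"] by (simp add: norm_reflect[OF e])
  have "p i \<bullet> (v i - v j) = 1" "p j \<bullet> (v i - v j) = -1"
    using dual_systemD[OF dual, of i i] dual_systemD[OF dual, of i j]
      dual_systemD[OF dual, of j i] dual_systemD[OF dual, of j j] ij by (simp_all add: inner_diff_right)
  then have pe: "e \<bullet> p i = 1 / norm (v i - v j)" "e \<bullet> p j = - (1 / norm (v i - v j))"
    by (simp_all add: e_def sgn_div_norm inner_commute inverse_eq_divide)
  have "e \<bullet> reflect e (p j) = e \<bullet> p i"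
    by (simp add: reflect_def inner_diff_right inner_add_right ee pe)
  then have "norm (p i) * (e \<bullet> p i) = norm (p j) * (e \<bullet> p i)"
    using arg_cong[OF par, of "(\<bullet>) e"] by simp
  moreover have "e \<bullet> p i \<noteq> 0" using pe \<open>v i \<noteq> v j\<close> by simp
  ultimately have n: "norm (p i) = norm (p j)" by simp
  then show "\<alpha> i = \<alpha> j" by (simp add: minimizer_touches[OF min \<rho> dual])
  have "p i \<noteq> 0" using \<open>e \<bullet> p i \<noteq> 0\<close> by auto
  with par n show "p i = reflect (sgn (v i - v j)) (p j)" by (auto simp: e_def)
qed

end

section \<open>Rigidity of minimisers\<close>

text \<open>The Gram matrix of the regular simplex with centre 0 and Euclidean inradius \<rho>: its
  circumradius is \<open>CARD('n) * \<rho>\<close>, and the cosine between two vertices is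
  \<open>-1 / CARD('n)\<close>. In Klein coordinates the same matrix serves the hyperbolic
  case.\<close>

definition centered_regular :: "real \<Rightarrow> ('n::finite option \<Rightarrow> real^'n) \<Rightarrow> bool" where
  "centered_regular \<rho> v \<longleftrightarrow>
     (\<forall>k l. v k \<bullet> v l = (if k = l then (real CARD('n) * \<rho>)\<^sup>2 else - (real CARD('n) * \<rho>\<^sup>2)))"

text \<open>Two unknowns, two equations: the barycentric representation of the origin gives
  \<open>a = - d * b\<close>, and touching gives \<open>b = - \<rho> * s\<close> with
  \<open>s\<close> the common norm of the vertices.\<close>

lemma centered_regular_of_gram:
  fixes v :: "'n option \<Rightarrow> real^'n"
  assumes dual: "dual_system v \<alpha> p" and touch: "\<And>k. \<alpha> k = \<rho> * norm (p k)" and \<rho>: "\<rho> > 0"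
    and gram: "\<And>k l. v k \<bullet> v l = (if k = l then a else b)"
  shows "centered_regular \<rho> v"
proof -
  define d where "d = real CARD('n)"
  obtain j :: "'n option" where j: "j \<noteq> None" by (metis option.distinct(1))
  have "0 < (v j - v None) \<bullet> (v j - v None)"
    using dual_system_inj[OF dual] j by (auto dest: injD)
  also have "\<dots> = 2 * (a - b)"
    using j j[symmetric] by (simp add: inner_diff_left inner_diff_right gram)
  finally have ab: "a - b > 0" by simp
  have sum1: "(\<Sum>k\<in>UNIV. \<alpha> k) = 1" and sumv: "(\<Sum>k\<in>UNIV. \<alpha> k *\<^sub>R v k) = 0"
    using dual_system_decomp[OF dual, of 0] by simp_all
  have \<alpha>: "\<alpha> l = - b / (a - b)" for l
  proof -
    have "0 = (\<Sum>k\<in>UNIV. \<alpha> k *\<^sub>R v k) \<bullet> v l" by (simp add: sumv)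
    also have "\<dots> = (\<Sum>k\<in>UNIV. \<alpha> k * b + (if k = l then \<alpha> k * (a - b) else 0))"
      by (simp add: inner_sum_left gram algebra_simps if_distrib cong: if_cong)
    also have "\<dots> = b + \<alpha> l * (a - b)"
      by (simp add: sum.distrib sum_distrib_right[symmetric] sum1)
    finally show ?thesis using ab by (simp add: field_simps)
  qed
  have "(d + 1) * (- b / (a - b)) = 1"
    using sum1 by (simp add: \<alpha> card_UNIV_option d_def add.commute)
  then have ad: "a = - d * b" using ab by (simp add: field_simps)
  \<comment> \<open>Each facet normal is parallel to the opposite vertex, since both affine
    functions agree at all vertices.\<close>
  have p: "p k = (1 / (a - b)) *\<^sub>R v k" for k
  proof (rule dual_system_affine_eqI(2)[OF dual])
    fix l
    have "a / (a - b) - b / (a - b) = 1" using ab by (simp add: diff_divide_distrib[symmetric])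
    then show "\<alpha> k + p k \<bullet> v l = \<alpha> k + ((1 / (a - b)) *\<^sub>R v k) \<bullet> v l"
      by (subst dual_systemD[OF dual]) (auto simp: gram \<alpha>)
  qed
  define s where "s = norm (v None)"
  have a: "a = s\<^sup>2" by (simp add: s_def power2_norm_eq_inner gram)
  have "- b / (a - b) = \<rho> * (s / (a - b))"
    using touch[of None] ab unfolding p \<alpha> by (simp add: s_def)
  then have "(- b) / (a - b) = (\<rho> * s) / (a - b)" by simp
  then have b: "b = - \<rho> * s" using ab by (subst (asm) divide_cancel_right) auto
  have "s * s = s * (d * \<rho>)" using ad a b by (simp add: power2_eq_square)
  moreover have "s \<noteq> 0" using ab a b by auto
  ultimately have s: "s = d * \<rho>" by simp
  show ?thesis
    unfolding centered_regular_def gram d_def[symmetric] a b s by (simp add: power2_eq_square)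
qed

lemma norm_combination_eq_of_gram_eq:
  fixes v w :: "'k::finite \<Rightarrow> 'a::real_inner"
  assumes "\<And>k l. v k \<bullet> v l = w k \<bullet> w l"
  shows "norm (\<Sum>k\<in>UNIV. c k *\<^sub>R v k) = norm (\<Sum>k\<in>UNIV. c k *\<^sub>R w k)"
  by (simp add: norm_eq_sqrt_inner inner_sum_left inner_sum_right assms)

text \<open>\<open>Q\<close> extends the vertex map affinely. It fixes the origin because the
  relation expressing 0 through the \<open>v k\<close> has the same norm for the \<open>w k\<close>;
  norms of all other combinations agree for the same reason.\<close>

lemma orthogonal_transformation_of_gram_eq:
  fixes v w :: "'n option \<Rightarrow> real^'n"
  assumes dual: "dual_system v \<alpha> p" and gram: "\<And>k l. v k \<bullet> v l = w k \<bullet> w l"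
  obtains Q where "orthogonal_transformation Q" "\<And>k. Q (v k) = w k"
proof -
  define Q where "Q x = (\<Sum>k\<in>UNIV. (p k \<bullet> x) *\<^sub>R w k)" for x
  have "norm (\<Sum>k\<in>UNIV. \<alpha> k *\<^sub>R w k) = norm (\<Sum>k\<in>UNIV. \<alpha> k *\<^sub>R v k)"
    using norm_combination_eq_of_gram_eq[of v w \<alpha>] gram by simp
  also have "\<dots> = 0" using dual_system_decomp(2)[OF dual, of 0] by simp
  finally have "Q x = (\<Sum>k\<in>UNIV. (\<alpha> k + p k \<bullet> x) *\<^sub>R w k)" for x
    by (simp add: Q_def scaleR_add_left sum.distrib)
  note Q = this
  have "linear Q" unfolding Q_def
    by (rule linearI) (auto simp: inner_add_right scaleR_add_left sum.distrib scaleR_sum_right)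
  moreover have "norm (Q x) = norm x" for x
    using norm_combination_eq_of_gram_eq[of v w "\<lambda>k. \<alpha> k + p k \<bullet> x"] gram
      dual_system_decomp(2)[OF dual, of x] by (simp add: Q)
  ultimately have "orthogonal_transformation Q"
    by (simp add: orthogonal_transformation)
  moreover have "Q (v l) = w l" for l
    unfolding Q dual_systemD[OF dual] by (simp add: if_distrib[of "\<lambda>c. c *\<^sub>R _"] cong: if_cong)
  ultimately show thesis using that by blast
qed

context radial_density
begin

text \<open>The mirror relations between facet normals are converted into relations between
  vertices: for each edge, \<open>v i - v j\<close> is orthogonal to every other vertex, and its
  products with \<open>v i\<close> and \<open>v j\<close> are opposite.\<close>

lemma minimizer_centered_regular:
  assumes min: "minimizer \<rho> v" and \<rho>: "\<rho> > 0"
  shows "centered_regular \<rho> v"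
proof -
  have "admissible \<rho> v" using min by (simp add: minimizer_def)
  from dual_system_of_admissible[OF this \<rho>] obtain \<alpha> p where dual: "dual_system v \<alpha> p" by blast
  have \<alpha>eq: "\<alpha> i = \<alpha> j" for i j
    using minimizer_reflect(2)[OF min \<rho> dual, of i j] by (cases "i = j") auto
  have *: "\<exists>c. c \<noteq> 0 \<and> (\<forall>k. c * ((v i - v j) \<bullet> v k) = (if i = k then 1 else 0) - (if j = k then 1 else 0))"
    if ij: "i \<noteq> j" for i j
  proof -
    define e where "e = sgn (v i - v j)"
    define c where "c = - (2 * (e \<bullet> p j)) / norm (v i - v j)"
    \<comment> \<open>A vector minus its mirror image is a multiple of the mirror normal, here the
      edge direction.\<close>
    have "p i - p j = - (2 * (e \<bullet> p j)) *\<^sub>R e"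
      using minimizer_reflect(1)[OF min \<rho> dual ij] by (simp add: e_def reflect_def)
    then have pp: "p i - p j = c *\<^sub>R (v i - v j)"
      by (simp add: c_def e_def sgn_div_norm divide_inverse mult.assoc)
    have "c * ((v i - v j) \<bullet> v k) = (if i = k then 1 else 0) - (if j = k then 1 else 0)" for k
    proof -
      have "c * ((v i - v j) \<bullet> v k) = (p i - p j) \<bullet> v k" by (simp add: pp)
      also have "\<dots> = (\<alpha> i + p i \<bullet> v k) - (\<alpha> j + p j \<bullet> v k)"
        using \<alpha>eq[of i j] by (simp add: inner_diff_left)
      finally show ?thesis by (simp add: dual_systemD[OF dual])
    qed
    note c = this
    from c[of i] ij have "c \<noteq> 0" by auto
    with c show ?thesis by blast
  qed
  have key: "v i \<bullet> v k = v j \<bullet> v k" if ij: "i \<noteq> j" "k \<noteq> i" "k \<noteq> j" for i j k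
  proof -
    from *[OF ij(1)] obtain c where "c \<noteq> 0"
      "\<And>k. c * ((v i - v j) \<bullet> v k) = (if i = k then 1 else 0) - (if j = k then 1 else 0)" by blast
    from this(1) this(2)[of k] ij show ?thesis by (auto simp: inner_diff_left)
  qed
  have key2: "v i \<bullet> v i = v j \<bullet> v j" if ij: "i \<noteq> j" for i j
  proof -
    from *[OF ij] obtain c where c: "c \<noteq> 0"
      "\<And>k. c * ((v i - v j) \<bullet> v k) = (if i = k then 1 else 0) - (if j = k then 1 else 0)" by blast
    have "c * ((v i - v j) \<bullet> v i) + c * ((v i - v j) \<bullet> v j) = 0"
      unfolding c using ij by simp
    then have "c * ((v i - v j) \<bullet> (v i + v j)) = 0"
      by (simp only: inner_add_right distrib_left)
    then show ?thesis using c(1) by (simp add: inner_diff_left inner_diff_right inner_add_right inner_commute)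
  qed
  define a where "a = v None \<bullet> v None"
  have diag: "v k \<bullet> v k = a" for k
    unfolding a_def using key2[of k None] by (cases "k = None") auto
  have s: "(\<Sum>k\<in>UNIV. \<alpha> k *\<^sub>R v k) = 0" "(\<Sum>k\<in>UNIV. \<alpha> k) = 1"
    using dual_system_decomp[OF dual, of 0] by simp_all
  have "(\<Sum>k\<in>UNIV. \<alpha> None *\<^sub>R v k) = 0"
    using s(1) by (subst sum.cong[OF refl, of _ _ "\<lambda>k. \<alpha> k *\<^sub>R v k"]) (auto intro: \<alpha>eq)
  then have "\<alpha> None *\<^sub>R (\<Sum>k\<in>UNIV. v k) = 0" by (simp add: scaleR_sum_right)
  moreover have "\<alpha> None \<noteq> 0"
  proof
    assume "\<alpha> None = 0"
    then have "\<alpha> k = 0" for k using \<alpha>eq by metis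
    then show False using s(2) by simp
  qed
  ultimately have sum0: "(\<Sum>k\<in>UNIV. v k) = 0" by simp
  \<comment> \<open>For fixed \<open>l\<close> the products of \<open>v l\<close> with the other
    vertices agree; the vertices sum to zero because all \<open>\<alpha> k\<close> are equal, so
    \<open>CARD('m)\<close> equal terms must balance the square of \<open>v l\<close>.\<close>
  have off: "v k \<bullet> v l = - a / real CARD('m)" if kl: "k \<noteq> l" for k l
  proof -
    have "0 = (\<Sum>j\<in>UNIV. v j) \<bullet> v l" by (simp add: sum0)
    also have "\<dots> = (\<Sum>j\<in>UNIV. v j \<bullet> v l)" by (simp add: inner_sum_left)
    also have "\<dots> = v l \<bullet> v l + (\<Sum>j\<in>UNIV - {l}. v j \<bullet> v l)" by (simp add: sum.remove[of UNIV l])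
    also have "(\<Sum>j\<in>UNIV - {l}. v j \<bullet> v l) = (\<Sum>j\<in>UNIV - {l}. v k \<bullet> v l)"
    proof (rule sum.cong)
      fix j assume "j \<in> UNIV - {l}"
      then show "v j \<bullet> v l = v k \<bullet> v l" using key[of j k l] kl by (cases "j = k") auto
    qed simp
    also have "\<dots> = real CARD('m) * (v k \<bullet> v l)"
      by (simp add: card_Diff_singleton card_UNIV_option)
    finally show ?thesis by (simp add: diag field_simps)
  qed
  show ?thesis
  proof (rule centered_regular_of_gram[OF dual minimizer_touches[OF min \<rho> dual] \<rho>])
    fix k l show "v k \<bullet> v l = (if k = l then a else - a / real CARD('m))"
      using diag off by simp
  qed
qed

lemma vol_centered_regular_eq:
  assumes v: "admissible \<rho> v" "centered_regular \<rho> v" and w: "centered_regular \<rho> w" and \<rho>: "\<rho> > 0"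
  shows "vol (convex hull (range w)) = vol (convex hull (range v))"
proof -
  from dual_system_of_admissible[OF v(1) \<rho>] obtain \<alpha> p where dual: "dual_system v \<alpha> p" by blast
  have "v k \<bullet> v l = w k \<bullet> w l" for k l using v(2) w by (simp add: centered_regular_def)
  from orthogonal_transformation_of_gram_eq[OF dual this]
  obtain Q where Q: "orthogonal_transformation Q" "\<And>k. Q (v k) = w k" by blast
  have "range w = Q ` range v" using Q(2) by (auto simp: image_image)
  then have "convex hull (range w) = Q ` (convex hull (range v))"
    using Q(1) by (simp add: convex_hull_linear_image orthogonal_transformation_linear)
  then show ?thesis
    using Q(1) by (simp add: vol_orthogonal finite_imp_compact_convex_hull)
qed

text \<open>A minimiser in the class capped by \<open>R\<close> has the same Gram matrix as
  \<open>v\<close>, hence is congruent to it. The cap only has to admit the two simplices being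
  compared.\<close>

lemma centered_regular_minimal:
  assumes v: "admissible \<rho> v" "centered_regular \<rho> v" and w: "admissible \<rho> w" and \<rho>: "\<rho> > 0"
  shows "vol (convex hull (range v)) \<le> vol (convex hull (range w))"
proof -
  obtain u where u: "minimizer \<rho> u" using minimizer_exists[OF w \<rho>] by blast
  then have "centered_regular \<rho> u" using \<rho> by (rule minimizer_centered_regular)
  then have "vol (convex hull (range v)) = vol (convex hull (range u))"
    using vol_centered_regular_eq[OF v _ \<rho>] by simp
  also have "\<dots> \<le> vol (convex hull (range w))" using u w by (simp add: minimizer_def)
  finally show ?thesis .
qed

end

section \<open>Regular simplices with touching facets\<close>

definition mdensity :: "geom \<Rightarrow> real^'n \<Rightarrow> real" where
  "mdensity M x = (case M of Euclid \<Rightarrow> 1 | Hyp \<Rightarrow> (1 - (norm x)\<^sup>2) powr (- (real CARD('n) + 1) / 2))"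

lemma mvol_eq_mdensity:
  assumes "S \<in> sets borel"
  shows "mvol M S = (\<integral>\<^sup>+ x. indicator S x * ennreal (mdensity M x) \<partial>lborel)"
  using assms by (cases M) (simp_all add: mvol_def mdensity_def)

text \<open>The inequality of arithmetic and geometric means twice: first for \<open>a\<close> and
  \<open>b\<close>, which puts their geometric mean below \<open>c\<close>, then for their
  powers.\<close>

lemma powr_neg_midpoint_convex:
  fixes a b c k :: real
  assumes "0 < a" "0 < b" "(a + b) / 2 \<le> c" "0 \<le> k"
  shows "2 * c powr (-k) \<le> a powr (-k) + b powr (-k)"
proof -
  have "sqrt (a * b) \<le> c" using arith_geo_mean_sqrt[of a b] assms by simp
  then have "c powr (-k) \<le> sqrt (a * b) powr (-k)"
    using assms by (intro powr_mono2') auto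
  also have "\<dots> = sqrt (a powr (-k) * b powr (-k))"
    using assms by (simp add: powr_half_sqrt[symmetric] powr_mult powr_powr mult.commute)
  also have "\<dots> \<le> (a powr (-k) + b powr (-k)) / 2" by (rule arith_geo_mean_sqrt) auto
  finally show ?thesis by simp
qed

lemma radial_density_mdensity:
  assumes "M = Hyp \<Longrightarrow> R < 1"
  shows "radial_density (mdensity M :: real^'m::{finite,wellorder} \<Rightarrow> real) R"
proof (cases M)
  case Euclid
  then have "mdensity M = (\<lambda>_::real^'m::_. 1)" by (simp add: mdensity_def fun_eq_iff)
  then show ?thesis by unfold_locales auto
next
  case Hyp
  then have R: "R < 1" using assms by simp
  define k where "k = (real CARD('m) + 1) / 2"
  have k: "0 \<le> k" by (simp add: k_def)
  have eq: "mdensity M = (\<lambda>x::real^'m::_. (1 - (norm x)\<^sup>2) powr (-k))"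
    using Hyp by (simp add: mdensity_def k_def fun_eq_iff minus_divide_left)
  have pos: "0 < 1 - (norm x)\<^sup>2" if "norm x \<le> R" for x :: "real^'m::_"
    using that R by (simp add: abs_square_less_1)
  show ?thesis unfolding eq
  proof
    show "1 \<le> (1 - (norm x)\<^sup>2) powr - k" if "norm x \<le> R" for x :: "real^'m::_"
    proof -
      have "1 powr (-k) \<le> (1 - (norm x)\<^sup>2) powr (-k)"
        using pos[OF that] k by (intro powr_mono2') auto
      then show ?thesis by simp
    qed
    show "\<exists>C. \<forall>x::real^'m::_. norm x \<le> R \<longrightarrow> (1 - (norm x)\<^sup>2) powr - k \<le> C"
    proof (intro exI allI impI)
      fix x :: "real^'m::_" assume x: "norm x \<le> R"
      have "0 \<le> R" using x norm_ge_zero[of x] by linarith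
      then have "0 < 1 - R\<^sup>2" using R by (simp add: abs_square_less_1)
      moreover have "(norm x)\<^sup>2 \<le> R\<^sup>2" using x by (intro power_mono) auto
      ultimately show "(1 - (norm x)\<^sup>2) powr - k \<le> (1 - R\<^sup>2) powr (-k)"
        using k by (intro powr_mono2') auto
    qed
    fix x y :: "real^'m::_" assume x: "norm x \<le> R" "norm y \<le> R"
    \<comment> \<open>The parallelogram law: passing to the midpoint can only increase
      \<open>1 - (norm x)\<^sup>2\<close> over the average.\<close>
    have eq: "(norm ((1/2) *\<^sub>R (x + y)))\<^sup>2 = ((norm x)\<^sup>2 + (norm y)\<^sup>2) / 2 - (norm (x - y))\<^sup>2 / 4"
      by (simp only: power2_norm_eq_inner) (simp add: inner_add_left inner_add_right inner_diff_left inner_diff_right inner_commute field_simps)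
    have "((1 - (norm x)\<^sup>2) + (1 - (norm y)\<^sup>2)) / 2 \<le> 1 - (norm ((1/2) *\<^sub>R (x + y)))\<^sup>2"
      unfolding eq using zero_le_power2[of "norm (x - y)"] by (simp add: field_simps)
    then show "2 * (1 - (norm ((1/2) *\<^sub>R (x + y)))\<^sup>2) powr - k
        \<le> (1 - (norm x)\<^sup>2) powr - k + (1 - (norm y)\<^sup>2) powr - k"
      using pos x k by (intro powr_neg_midpoint_convex) auto
  qed (simp_all)
qed

text \<open>The reversed Cauchy-Schwarz inequality for the timelike vectors \<open>(1, u)\<close>
  and \<open>(1, v)\<close>. The difference of the squares is written as a positive term plus a
  square.\<close>

lemma lorentz_cauchy_schwarz:
  fixes u v :: "real^'n"
  assumes "norm u < 1" "norm v < 1" "u \<noteq> v"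
  shows "sqrt ((1 - (norm u)\<^sup>2) * (1 - (norm v)\<^sup>2)) < 1 - u \<bullet> v"
proof -
  have "\<bar>u \<bullet> v\<bar> \<le> norm u * norm v" by (rule Cauchy_Schwarz_ineq2)
  also have "\<dots> \<le> norm u * 1" using assms by (intro mult_left_mono) auto
  finally have uv: "u \<bullet> v < 1" using assms by simp
  have eq: "(1 - u \<bullet> v)\<^sup>2 - (1 - (norm u)\<^sup>2) * (1 - (norm v)\<^sup>2)
      = (1 - (norm u)\<^sup>2) * (norm (v - u))\<^sup>2 + (u \<bullet> v - (norm u)\<^sup>2)\<^sup>2"
    by (simp only: power2_norm_eq_inner)
      (simp add: inner_diff_left inner_diff_right inner_commute power2_eq_square algebra_simps)
  have "0 < (1 - (norm u)\<^sup>2) * (norm (v - u))\<^sup>2"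
    using assms by (intro mult_pos_pos) (auto simp: abs_square_less_1)
  then have "(1 - (norm u)\<^sup>2) * (1 - (norm v)\<^sup>2) < (1 - u \<bullet> v)\<^sup>2"
    using eq zero_le_power2[of "u \<bullet> v - (norm u)\<^sup>2"] by linarith
  then have "sqrt ((1 - (norm u)\<^sup>2) * (1 - (norm v)\<^sup>2)) < sqrt ((1 - u \<bullet> v)\<^sup>2)"
    by (rule real_sqrt_less_mono)
  then show ?thesis using uv by simp
qed

lemma mdist_Hyp_cosh:
  fixes u v :: "real^'n"
  assumes "norm u < 1" "norm v < 1"
  shows "cosh (mdist Hyp u v) = (1 - u \<bullet> v) / sqrt ((1 - (norm u)\<^sup>2) * (1 - (norm v)\<^sup>2))"
proof -
  have pos: "0 < (1 - (norm u)\<^sup>2) * (1 - (norm v)\<^sup>2)"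
    using assms by (intro mult_pos_pos) (auto simp: abs_square_less_1)
  have "sqrt ((1 - (norm u)\<^sup>2) * (1 - (norm v)\<^sup>2)) \<le> 1 - u \<bullet> v"
  proof (cases "u = v")
    case True
    moreover have "(norm v)\<^sup>2 < 1" using assms by (simp add: abs_square_less_1)
    ultimately show ?thesis by (simp add: power2_norm_eq_inner flip: power2_eq_square)
  qed (use lorentz_cauchy_schwarz[OF assms] in simp)
  then have "1 \<le> (1 - u \<bullet> v) / sqrt ((1 - (norm u)\<^sup>2) * (1 - (norm v)\<^sup>2))"
    using pos by (simp add: divide_simps)
  then show ?thesis by (simp add: mdist_def)
qed

section \<open>Gram matrices of regular circumscribed simplices\<close>

text \<open>Equal edges do not yet place the simplex; touching does, by making the origin
  equidistant from the vertices. Differences of coordinates are expressed through squared distances,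
  which shows that all \<open>p k\<close> have equal length, then that all \<open>\<alpha> k\<close>
  agree, and finally that all vertices have equal norm.\<close>

lemma regular_touching_gram_Euclid:
  fixes v :: "'n option \<Rightarrow> real^'n"
  assumes dual: "dual_system v \<alpha> p" and touch: "\<And>k. \<alpha> k = \<rho> * norm (p k)"
    and reg: "\<And>k l. k \<noteq> l \<Longrightarrow> dist (v k) (v l) = D"
  shows "\<exists>a b. \<forall>k l. v k \<bullet> v l = (if k = l then a else b)"
proof -
  obtain j :: "'n option" where j: "j \<noteq> None" by (metis option.distinct(1))
  have "D > 0" using reg[OF j] dual_system_inj[OF dual] j by (metis injD zero_less_dist_iff)
  have sq: "(v k - v l) \<bullet> (v k - v l) = (if k = l then 0 else D\<^sup>2)" for k l
    using reg[of k l] by (auto simp: dist_norm power2_norm_eq_inner)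
  have diff: "\<alpha> k - \<alpha> m = - (v k \<bullet> v k - v m \<bullet> v m) / D\<^sup>2 \<and> p k - p m = (2 / D\<^sup>2) *\<^sub>R (v k - v m)" for k m
  proof -
    have "(\<alpha> k - \<alpha> m) + (p k - p m) \<bullet> v l
        = - (v k \<bullet> v k - v m \<bullet> v m) / D\<^sup>2 + ((2 / D\<^sup>2) *\<^sub>R (v k - v m)) \<bullet> v l" for l
    proof -
      have "(\<alpha> k - \<alpha> m) + (p k - p m) \<bullet> v l = (if k = l then 1 else 0) - (if m = l then 1 else 0)"
        using dual_systemD[OF dual, of k l] dual_systemD[OF dual, of m l] by (simp add: inner_diff_left)
      also have "\<dots> = ((v m - v l) \<bullet> (v m - v l) - (v k - v l) \<bullet> (v k - v l)) / D\<^sup>2"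
        using \<open>D > 0\<close> unfolding sq by simp
      also have "(v m - v l) \<bullet> (v m - v l) - (v k - v l) \<bullet> (v k - v l)
          = - (v k \<bullet> v k - v m \<bullet> v m) + 2 * ((v k - v m) \<bullet> v l)"
        by (simp add: inner_diff_left inner_diff_right inner_commute)
      finally show ?thesis by (simp add: add_divide_distrib diff_divide_distrib)
    qed
    from dual_system_affine_eqI[OF dual this] show ?thesis by blast
  qed
  have norm_eq: "v k \<bullet> v k = v m \<bullet> v m" for k m
  proof (cases "k = m")
    case False
    \<comment> \<open>The first factor is parallel to the edge from \<open>v m\<close> to
      \<open>v k\<close>, and the sum of coordinates k and m takes the same value at both ends, so
      the product vanishes.\<close>
    have "(p k - p m) \<bullet> (p k + p m) = (2 / D\<^sup>2) * ((\<alpha> k + p k \<bullet> v k) + (\<alpha> m + p m \<bullet> v k)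
        - (\<alpha> k + p k \<bullet> v m) - (\<alpha> m + p m \<bullet> v m))"
      using diff[of k m] by (simp add: inner_diff_left inner_diff_right inner_add_right inner_commute)
    also have "\<dots> = 0" using False by (simp add: dual_systemD[OF dual])
    finally have "p k \<bullet> p k = p m \<bullet> p m"
      by (simp add: inner_diff_left inner_diff_right inner_add_right inner_commute)
    then have "norm (p k) = norm (p m)" by (simp add: norm_eq_sqrt_inner)
    then have "\<alpha> k = \<alpha> m" by (simp add: touch)
    then show ?thesis using diff[of k m] \<open>D > 0\<close> by simp
  qed simp
  have "v k \<bullet> v l = (2 * (v None \<bullet> v None) - D\<^sup>2) / 2" if "k \<noteq> l" for k l
    using sq[of k l] that norm_eq[of k None] norm_eq[of l None]
    by (simp add: inner_diff_left inner_diff_right inner_commute)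
  with norm_eq have "\<forall>k l. v k \<bullet> v l = (if k = l then v None \<bullet> v None else (2 * (v None \<bullet> v None) - D\<^sup>2) / 2)"
    by auto
  then show ?thesis by blast
qed

text \<open>The Euclidean argument, with the vertices lifted to the vectors \<open>w k (1, v k)\<close> of the hyperboloid
  and the scalar product replaced by the Lorentz form.\<close>

lemma regular_touching_gram_Hyp:
  fixes v :: "'n option \<Rightarrow> real^'n"
  assumes dual: "dual_system v \<alpha> p" and touch: "\<And>k. \<alpha> k = \<rho> * norm (p k)"
    and \<rho>: "0 < \<rho>" "\<rho> < 1" and v1: "\<And>k. norm (v k) < 1"
    and reg: "\<And>k l. k \<noteq> l \<Longrightarrow> mdist Hyp (v k) (v l) = D"
  shows "\<exists>a b. \<forall>k l. v k \<bullet> v l = (if k = l then a else b)"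
proof -
  define w where "w k = 1 / sqrt (1 - (norm (v k))\<^sup>2)" for k
  have v2: "0 < 1 - (norm (v k))\<^sup>2" for k using v1[of k] by (simp add: abs_square_less_1)
  have w0: "w k > 0" for k using v2[of k] by (simp add: w_def)
  define C where "C = cosh D"
  have wC: "w k * w l * (1 - v k \<bullet> v l) = C" if "k \<noteq> l" for k l
    using mdist_Hyp_cosh[OF v1 v1, of k l] reg[OF that] by (simp add: w_def C_def real_sqrt_mult)
  have wG: "w k * w l * (1 - v k \<bullet> v l) = (if k = l then 1 else C)" for k l
    using wC[of k l] v2[of l] by (auto simp: w_def power2_norm_eq_inner simp flip: power2_eq_square)
  have "C \<noteq> 1"
  proof
    assume C: "C = 1"
    obtain j :: "'n option" where j: "j \<noteq> None" by (metis option.distinct(1))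
    then have "v j \<noteq> v None" using dual_system_inj[OF dual] by (auto dest: injD)
    note lorentz_cauchy_schwarz[OF v1 v1 this]
    moreover have "(1 - v j \<bullet> v None) / sqrt ((1 - (norm (v j))\<^sup>2) * (1 - (norm (v None))\<^sup>2)) = 1"
      by (metis C C_def mdist_Hyp_cosh reg[OF j] v1)
    ultimately show False by (simp add: divide_eq_1_iff)
  qed
  define \<beta> where "\<beta> k = \<alpha> k / w k" for k
  define s where "s k = (1 / w k) *\<^sub>R p k" for k
  have bs: "w l * (\<beta> k + s k \<bullet> v l) = (if k = l then 1 else 0)" for k l
  proof -
    have "\<beta> k + s k \<bullet> v l = (\<alpha> k + p k \<bullet> v l) / w k"
      by (simp add: \<beta>_def s_def add_divide_distrib)
    then show ?thesis using w0[of l] by (simp add: dual_systemD[OF dual])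
  qed
  \<comment> \<open>The Lorentz Gram matrix has entries 1 and \<open>C\<close>; since
    \<open>C\<close> differs from 1, \<open>c\<close> rescales differences of its rows to
    differences of Kronecker deltas.\<close>
  define c where "c = 1 / (1 - C)"
  have c: "c * (1 - C) = 1" "c \<noteq> 0" using \<open>C \<noteq> 1\<close> by (simp_all add: c_def)
  have diff: "\<beta> k - \<beta> m = c * (w k - w m) \<and> s k - s m = (- c) *\<^sub>R (w k *\<^sub>R v k - w m *\<^sub>R v m)"
    for k m
  proof -
    have "(\<beta> k - \<beta> m) + (s k - s m) \<bullet> v l
        = c * (w k - w m) + ((- c) *\<^sub>R (w k *\<^sub>R v k - w m *\<^sub>R v m)) \<bullet> v l" (is "?L = ?R") for l
    proof -
      have "w l * ?L = w l * (\<beta> k + s k \<bullet> v l) - w l * (\<beta> m + s m \<bullet> v l)"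
        by (simp add: inner_diff_left algebra_simps)
      also have "\<dots> = (if k = l then 1 else 0) - (if m = l then 1 else 0)" unfolding bs ..
      also have "\<dots> = (w k * w l * (1 - v k \<bullet> v l) - w m * w l * (1 - v m \<bullet> v l)) * c"
        unfolding wG using c by (auto simp: algebra_simps)
      also have "\<dots> = w l * ?R"
        by (simp add: inner_diff_left algebra_simps)
      finally show ?thesis using w0[of l] by simp
    qed
    from dual_system_affine_eqI[OF dual this] show ?thesis by blast
  qed
  have w_eq: "w k = w m" for k m
  proof (cases "k = m")
    case False
    have "(\<beta> k - \<beta> m) * (\<beta> k + \<beta> m) - (s k - s m) \<bullet> (s k + s m)
       = c * ((w k - w m) * (\<beta> k + \<beta> m) + (w k *\<^sub>R v k - w m *\<^sub>R v m) \<bullet> (s k + s m))"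
      unfolding diff[of k m, THEN conjunct1] diff[of k m, THEN conjunct2]
      by (simp add: algebra_simps)
    also have "(w k - w m) * (\<beta> k + \<beta> m) + (w k *\<^sub>R v k - w m *\<^sub>R v m) \<bullet> (s k + s m) = w k * (\<beta> k + s k \<bullet> v k) + w k * (\<beta> m + s m \<bullet> v k)
        - w m * (\<beta> k + s k \<bullet> v m) - w m * (\<beta> m + s m \<bullet> v m)"
      by (simp add: inner_diff_left inner_add_right inner_commute algebra_simps)
    also have "\<dots> = 0" unfolding bs using False by simp
    finally have "(\<beta> k - \<beta> m) * (\<beta> k + \<beta> m) - (s k - s m) \<bullet> (s k + s m) = 0"
      by simp
    then have 1: "(\<beta> k)\<^sup>2 - (norm (s k))\<^sup>2 = (\<beta> m)\<^sup>2 - (norm (s m))\<^sup>2"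
      unfolding power2_norm_eq_inner
      by (simp add: inner_diff_left inner_add_right inner_commute power2_eq_square algebra_simps)
    have t: "\<beta> i = \<rho> * norm (s i)" for i
      using touch[of i] w0[of i] by (simp add: \<beta>_def s_def)
    \<comment> \<open>The lifted normals have equal Lorentz norms. Touching ties
      \<open>\<beta> k\<close> to \<open>norm (s k)\<close>, and \<rho> below 1 allows cancelling
      the common factor to obtain equal Euclidean norms.\<close>
    have "(1 - \<rho>\<^sup>2) * (norm (s k))\<^sup>2 = (1 - \<rho>\<^sup>2) * (norm (s m))\<^sup>2"
      using 1 by (simp add: t power_mult_distrib algebra_simps)
    moreover have "1 - \<rho>\<^sup>2 \<noteq> 0" using \<rho> by (simp add: power2_eq_1_iff)
    ultimately have "norm (s k) = norm (s m)" by simp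
    then have "\<beta> k = \<beta> m" by (simp add: t)
    then show ?thesis using diff[of k m] c(2) by simp
  qed simp
  have "1 - v k \<bullet> v l = (if k = l then 1 else C) / (w None)\<^sup>2" for k l
  proof -
    have "(w None)\<^sup>2 * (1 - v k \<bullet> v l) = (if k = l then 1 else C)"
      using wG[of k l] w_eq[of k None] w_eq[of l None] by (simp add: power2_eq_square)
    then show ?thesis using w0[of None] by (simp add: eq_divide_eq mult.commute)
  qed
  then have "v k \<bullet> v l = (if k = l then 1 - 1 / (w None)\<^sup>2 else 1 - C / (w None)\<^sup>2)" for k l
    by (smt (verit, ccfv_threshold))
  then show ?thesis by blast
qed

section \<open>Balls centred at the origin\<close>

text \<open>A common point of facet and ball reverses the inequality that containment gives.
  Conversely, the point of the ball minimising the k-th coordinate has coordinate 0 and so is a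
  combination of the remaining vertices.\<close>

lemma hull_vertex_facet_touch:
  fixes v :: "'n option \<Rightarrow> real^'n"
  assumes dual: "dual_system v \<alpha> p" and \<rho>: "0 \<le> \<rho>" and sub: "cball 0 \<rho> \<subseteq> convex hull (range v)"
  shows "convex hull (range v - {v k}) \<inter> cball 0 \<rho> \<noteq> {} \<longleftrightarrow> \<alpha> k = \<rho> * norm (p k)"
proof
  assume "convex hull (range v - {v k}) \<inter> cball 0 \<rho> \<noteq> {}"
  then obtain y where y: "y \<in> convex hull (range v - {v k})" "norm y \<le> \<rho>" by auto
  have "range v - {v k} \<subseteq> {x. p k \<bullet> x = - \<alpha> k}"
  proof
    fix x assume "x \<in> range v - {v k}"
    then obtain l where "x = v l" "l \<noteq> k" by auto
    then show "x \<in> {x. p k \<bullet> x = - \<alpha> k}" using dual_systemD[OF dual, of k l] by simp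
  qed
  then have "convex hull (range v - {v k}) \<subseteq> {x. p k \<bullet> x = - \<alpha> k}"
    by (rule hull_minimal) (rule convex_hyperplane)
  then have "\<alpha> k = - (p k \<bullet> y)" using y by auto
  also have "\<dots> \<le> norm (p k) * norm y" by (metis Cauchy_Schwarz_ineq2 abs_le_D2)
  also have "\<dots> \<le> norm (p k) * \<rho>" using y by (intro mult_left_mono) auto
  finally show "\<alpha> k = \<rho> * norm (p k)"
    using sub unfolding dual_system_cball[OF dual \<rho>] by (simp add: antisym mult.commute)
next
  assume t: "\<alpha> k = \<rho> * norm (p k)"
  define x where "x = (- \<rho>) *\<^sub>R sgn (p k)"
  have x: "x \<in> cball 0 \<rho>" using \<rho> by (simp add: x_def norm_sgn)
  have k0: "\<alpha> k + p k \<bullet> x = 0" by (simp add: x_def t inner_sgn_self)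
  have ge: "0 \<le> \<alpha> l + p l \<bullet> x" for l using sub x unfolding dual_system_hull[OF dual] by auto
  have "x = (\<Sum>l\<in>UNIV. (\<alpha> l + p l \<bullet> x) *\<^sub>R v l)" by (simp add: dual_system_decomp[OF dual])
  also have "\<dots> = (\<Sum>l\<in>UNIV - {k}. (\<alpha> l + p l \<bullet> x) *\<^sub>R v l)"
    by (simp add: sum.remove[of UNIV k] k0)
  also have "\<dots> \<in> convex hull (range v - {v k})"
  proof (rule convex_sum)
    have "1 = (\<Sum>l\<in>UNIV. \<alpha> l + p l \<bullet> x)" by (simp add: dual_system_decomp[OF dual])
    also have "\<dots> = (\<Sum>l\<in>UNIV - {k}. \<alpha> l + p l \<bullet> x)" by (simp add: sum.remove[of UNIV k] k0)
    finally show "(\<Sum>l\<in>UNIV - {k}. \<alpha> l + p l \<bullet> x) = 1" by simp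
    show "v l \<in> convex hull (range v - {v k})" if "l \<in> UNIV - {k}" for l
      using that dual_system_inj[OF dual] by (intro hull_inc) (auto dest: injD)
  qed (use ge convex_convex_hull in auto)
  finally show "convex hull (range v - {v k}) \<inter> cball 0 \<rho> \<noteq> {}" using x by auto
qed

lemma mdist_of_gram:
  fixes v :: "'k \<Rightarrow> real^'n"
  assumes gram: "\<And>k l. v k \<bullet> v l = (if k = l then a else b)" and "k \<noteq> l"
  shows "mdist M (v k) (v l) = (case M of Euclid \<Rightarrow> sqrt (2 * a - 2 * b)
     | Hyp \<Rightarrow> arcosh ((1 - b) / sqrt ((1 - a) * (1 - a))))"
  using assms by (cases M)
    (simp_all add: mdist_def dist_norm norm_eq_sqrt_inner[of "v k - v l"] inner_diff_left inner_diff_right power2_norm_eq_inner gram)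

text \<open>The cap \<open>R\<close> is chosen differently in the two directions: from
  \<open>V\<close> alone when \<open>V\<close> is minimal, and large enough for both simplices when
  \<open>V\<close> is compared with a given \<open>W\<close>.\<close>

theorem minimal_iff_regular_circumscribed_centered:
  fixes V :: "(real^'m::{finite,wellorder}) set"
  assumes V: "msimplex_vertices M V" and \<rho>: "\<rho> > 0" and sub: "cball 0 \<rho> \<subseteq> convex hull V"
  shows "(\<forall>W::(real^'m::_) set. msimplex_vertices M W \<and> cball 0 \<rho> \<subseteq> convex hull W
             \<longrightarrow> mvol M (convex hull V) \<le> mvol M (convex hull W))
         \<longleftrightarrow> mregular M V \<and> circumscribed (cball 0 \<rho>) V"
proof -
  have enum: "\<exists>w :: 'm option \<Rightarrow> real^'m::_. inj w \<and> range w = W" if "msimplex_vertices M W" for W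
  proof -
    have "finite W" "card W = card (UNIV :: 'm option set)"
      using that by (auto simp: msimplex_vertices_def card_UNIV_option)
    then obtain w where "bij_betw w (UNIV :: 'm option set) W"
      by (metis finite_same_card_bij finite)
    then show ?thesis by (auto simp: bij_betw_def)
  qed
  \<comment> \<open>Finitely many points of the open unit ball lie in a smaller concentric closed
    ball.\<close>
  have bound: "\<exists>R. (\<forall>x\<in>W. norm x \<le> R) \<and> (M = Hyp \<longrightarrow> R < 1)" if "msimplex_vertices M W" for W :: "(real^'m::_) set"
  proof -
    have W: "finite W" "W \<noteq> {}" "W \<subseteq> mspace M"
      using that by (auto simp: msimplex_vertices_def)
    then have "\<forall>x\<in>W. norm x \<le> Max (norm ` W)" by simp
    moreover have "Max (norm ` W) < 1" if "M = Hyp"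
      using W that by (auto simp: mspace_def)
    ultimately show ?thesis by blast
  qed
  obtain v :: "'m option \<Rightarrow> real^'m::_" where v: "inj v" "range v = V" using enum[OF V] by blast
  have sub_v: "cball 0 \<rho> \<subseteq> convex hull (range v)" using sub v by simp
  obtain \<alpha> p where dual: "dual_system v \<alpha> p"
    using dual_system_exists[OF cball_interior_nonempty[OF sub_v \<rho>]] by blast
  have hull_borel: "convex hull (range w) \<in> sets borel" for w :: "'m option \<Rightarrow> real^'m::_"
    by (intro borel_compact finite_imp_compact_convex_hull) simp
  have circ: "circumscribed (cball 0 \<rho>) V \<longleftrightarrow> (\<forall>k. \<alpha> k = \<rho> * norm (p k))"
    using sub hull_vertex_facet_touch[OF dual less_imp_le[OF \<rho>] sub_v] v(2)
    by (auto simp: circumscribed_def)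
  show ?thesis
  proof (intro iffI conjI)
    assume L: "\<forall>W::(real^'m::_) set. msimplex_vertices M W \<and> cball 0 \<rho> \<subseteq> convex hull W
             \<longrightarrow> mvol M (convex hull V) \<le> mvol M (convex hull W)"
    obtain R where R: "\<forall>x\<in>V. norm x \<le> R" "M = Hyp \<Longrightarrow> R < 1" using bound[OF V] by blast
    interpret radial_density "mdensity M :: real^'m::_ \<Rightarrow> real" R
      using R(2) by (rule radial_density_mdensity)
    have vol: "mvol M (convex hull (range w)) = vol (convex hull (range w))" for w :: "'m option \<Rightarrow> real^'m::_"
      using hull_borel by (simp add: mvol_eq_mdensity vol_def)
    have min: "minimizer \<rho> v"
      unfolding minimizer_def
    proof (intro conjI allI impI)
      show "admissible \<rho> v" using R(1) sub_v v by (auto simp: admissible_def)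
      fix w assume w: "admissible \<rho> w"
      then obtain \<beta> s where dw: "dual_system w \<beta> s" using dual_system_of_admissible[OF _ \<rho>] by blast
      have "range w \<subseteq> mspace M"
        using w R(2) by (cases M) (force simp: admissible_def mspace_def intro: le_less_trans)+
      then have "msimplex_vertices M (range w)"
        using dual_system_affine_independent[OF dw] dual_system_inj[OF dw]
        by (simp add: msimplex_vertices_def card_image card_UNIV_option)
      with L w have "mvol M (convex hull V) \<le> mvol M (convex hull (range w))"
        by (simp add: admissible_def)
      then show "vol (convex hull (range v)) \<le> vol (convex hull (range w))"
        using vol[of v] vol[of w] v(2) by simp
    qed
    show "circumscribed (cball 0 \<rho>) V"
      unfolding circ using minimizer_touches[OF min \<rho> dual] by blast
    have "centered_regular \<rho> v" using min \<rho> by (rule minimizer_centered_regular)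
    then have "v k \<bullet> v l = (if k = l then (real CARD('m) * \<rho>)\<^sup>2 else - (real CARD('m) * \<rho>\<^sup>2))" for k l
      by (simp add: centered_regular_def)
    from mdist_of_gram[OF this, where M = M]
    obtain D where D: "\<And>k l. k \<noteq> l \<Longrightarrow> mdist M (v k) (v l) = D" by blast
    show "mregular M V"
      unfolding mregular_def v(2)[symmetric] by (auto, metis D)
  next
    assume "mregular M V \<and> circumscribed (cball 0 \<rho>) V"
    then have reg: "mregular M V" and touch: "\<And>k. \<alpha> k = \<rho> * norm (p k)" by (auto simp: circ)
    define D where "D = mdist M (v None) (v (Some undefined))"
    have D: "mdist M (v k) (v l) = D" if "k \<noteq> l" for k l
      using reg that v unfolding mregular_def D_def by (metis injD option.distinct(1) rangeI)
    have "\<exists>a b. \<forall>k l. v k \<bullet> v l = (if k = l then a else b)"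
    proof (cases M)
      case Euclid
      then show ?thesis using regular_touching_gram_Euclid[OF dual touch] D by (simp add: mdist_def)
    next
      case Hyp
      then have "V \<subseteq> ball 0 1" using V by (simp add: msimplex_vertices_def mspace_def)
      moreover from this have "convex hull V \<subseteq> ball 0 1" by (rule hull_minimal) (rule convex_ball)
      then have "cball (0::real^'m::_) \<rho> \<subseteq> ball 0 1" using sub by blast
      then have "\<rho> < 1" using \<rho> by (simp add: cball_subset_ball_iff)
      ultimately show ?thesis
        using regular_touching_gram_Hyp[OF dual touch \<rho>] D Hyp v(2) by (force simp: subset_iff)
    qed
    then obtain a b where "\<And>k l. v k \<bullet> v l = (if k = l then a else b)" by blast
    from centered_regular_of_gram[OF dual touch \<rho> this]
    have cr: "centered_regular \<rho> v" .
    show "\<forall>W::(real^'m::_) set. msimplex_vertices M W \<and> cball 0 \<rho> \<subseteq> convex hull W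
             \<longrightarrow> mvol M (convex hull V) \<le> mvol M (convex hull W)"
    proof (intro allI impI, elim conjE)
      fix W :: "(real^'m::_) set" assume W: "msimplex_vertices M W" "cball 0 \<rho> \<subseteq> convex hull W"
      obtain w :: "'m option \<Rightarrow> real^'m::_" where w: "range w = W" using enum[OF W(1)] by blast
      obtain R1 R2 where R12: "\<forall>x\<in>V. norm x \<le> R1" "M = Hyp \<Longrightarrow> R1 < 1" "\<forall>x\<in>W. norm x \<le> R2" "M = Hyp \<Longrightarrow> R2 < 1"
        using bound[OF V] bound[OF W(1)] by blast
      define R where "R = max R1 R2"
      have R: "M = Hyp \<Longrightarrow> R < 1" using R12 by (simp add: R_def)
      interpret radial_density "mdensity M :: real^'m::_ \<Rightarrow> real" R
        using R by (rule radial_density_mdensity)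
      have vol: "mvol M (convex hull (range w)) = vol (convex hull (range w))" for w :: "'m option \<Rightarrow> real^'m::_"
        using hull_borel by (simp add: mvol_eq_mdensity vol_def)
      have "norm x \<le> R" if "x \<in> V \<union> W" for x
        using R12 that by (auto simp: R_def le_max_iff_disj)
      then have "admissible \<rho> v" "admissible \<rho> w"
        using sub W(2) v(2) w by (auto simp: admissible_def)
      from centered_regular_minimal[OF this(1) cr this(2) \<rho>]
      show "mvol M (convex hull V) \<le> mvol M (convex hull W)"
        using vol[of v] vol[of w] v(2) w by simp
    qed
  qed
qed

section \<open>Isometries of the models\<close>

definition minimal_iff_regular :: "geom \<Rightarrow> (real^'n) set \<Rightarrow> (real^'n) set \<Rightarrow> bool" where
  "minimal_iff_regular M B V \<longleftrightarrow>
     ((\<forall>W. msimplex_vertices M W \<and> B \<subseteq> convex hull W \<longrightarrow> mvol M (convex hull V) \<le> mvol M (convex hull W))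
       \<longleftrightarrow> mregular M V \<and> circumscribed B V)"

lemma convex_mspace: "convex (mspace M)"
  by (cases M) (simp_all add: mspace_def)

lemma hull_subset_mspace: "S \<subseteq> mspace M \<Longrightarrow> convex hull S \<subseteq> mspace M"
  by (rule hull_minimal) (auto simp: convex_mspace)

text \<open>Tailored to hyperbolic boosts, which are projective rather than affine and well behaved
  only on \<open>mspace M\<close>; hence hulls and volumes are asked for only on finite subsets of
  the model. Two index types allow a mere relabelling of coordinates as well.\<close>

locale model_isometry =
  fixes M :: geom and \<phi> :: "real^'n \<Rightarrow> real^'m" and \<psi> :: "real^'m \<Rightarrow> real^'n"
  assumes card_eq: "CARD('n) = CARD('m)"
    and maps: "x \<in> mspace M \<Longrightarrow> \<phi> x \<in> mspace M" "y \<in> mspace M \<Longrightarrow> \<psi> y \<in> mspace M"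
    and inverse: "x \<in> mspace M \<Longrightarrow> \<psi> (\<phi> x) = x" "y \<in> mspace M \<Longrightarrow> \<phi> (\<psi> y) = y"
    and mdist: "x \<in> mspace M \<Longrightarrow> x' \<in> mspace M \<Longrightarrow> mdist M (\<phi> x) (\<phi> x') = mdist M x x'"
    and image_hull_subset: "finite S \<Longrightarrow> S \<subseteq> mspace M \<Longrightarrow> \<phi> ` (convex hull S) \<subseteq> convex hull (\<phi> ` S)"
      "finite T \<Longrightarrow> T \<subseteq> mspace M \<Longrightarrow> \<psi> ` (convex hull T) \<subseteq> convex hull (\<psi> ` T)"
    and mvol_image: "finite S \<Longrightarrow> S \<subseteq> mspace M \<Longrightarrow> mvol M (\<phi> ` (convex hull S)) = mvol M (convex hull S)"
begin

lemma image_inverse: "S \<subseteq> mspace M \<Longrightarrow> \<psi> ` \<phi> ` S = S" "T \<subseteq> mspace M \<Longrightarrow> \<phi> ` \<psi> ` T = T"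
  using inverse by (force simp: image_image)+

lemma image_mspace: "S \<subseteq> mspace M \<Longrightarrow> \<phi> ` S \<subseteq> mspace M" "T \<subseteq> mspace M \<Longrightarrow> \<psi> ` T \<subseteq> mspace M"
  using maps by auto

lemma inj_on_mspace: "inj_on \<phi> (mspace M)" "inj_on \<psi> (mspace M)"
  using inverse by (metis inj_onI)+

lemma image_hull:
  assumes "finite S" "S \<subseteq> mspace M"
  shows "\<phi> ` (convex hull S) = convex hull (\<phi> ` S)"
proof
  show "convex hull (\<phi> ` S) \<subseteq> \<phi> ` (convex hull S)"
  proof
    fix y assume y: "y \<in> convex hull (\<phi> ` S)"
    then have "y \<in> mspace M" using hull_subset_mspace image_mspace(1)[OF assms(2)] by blast
    have "\<psi> y \<in> convex hull (\<psi> ` \<phi> ` S)"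
      using image_hull_subset(2)[of "\<phi> ` S"] assms image_mspace y by blast
    then have "\<psi> y \<in> convex hull S" by (simp add: image_inverse assms)
    with inverse(2)[OF \<open>y \<in> mspace M\<close>] show "y \<in> \<phi> ` (convex hull S)" by (metis imageI)
  qed
qed (rule image_hull_subset(1)[OF assms])

lemma symmetric: "model_isometry M \<psi> \<phi>"
proof
  fix x x' :: "real^'m" assume "x \<in> mspace M" "x' \<in> mspace M"
  then show "mdist M (\<psi> x) (\<psi> x') = mdist M x x'"
    using mdist[of "\<psi> x" "\<psi> x'"] maps inverse by simp
next
  fix T :: "(real^'m) set" assume T: "finite T" "T \<subseteq> mspace M"
  then have "\<phi> ` (convex hull (\<psi> ` T)) = convex hull T"
    using image_hull[of "\<psi> ` T"] image_mspace by (simp add: image_inverse)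
  moreover from this have "\<psi> ` (convex hull T) = convex hull (\<psi> ` T)"
    using image_inverse(1)[of "convex hull (\<psi> ` T)"] hull_subset_mspace[OF image_mspace(2)[OF T(2)]] by simp
  ultimately show "mvol M (\<psi> ` (convex hull T)) = mvol M (convex hull T)"
    using mvol_image[of "\<psi> ` T"] T image_mspace by simp
qed (use card_eq maps inverse image_hull_subset in auto)

text \<open>As \<phi> need not be affine, dependence is expressed through hulls: a Radon partition
  of the image pulls back under \<psi> to one of \<open>V\<close>.\<close>

lemma affine_independent_image:
  assumes V: "finite V" "V \<subseteq> mspace M" and ind: "\<not> affine_dependent V"
  shows "\<not> affine_dependent (\<phi> ` V)"
proof
  assume "affine_dependent (\<phi> ` V)"
  then obtain P Q where PQ: "P \<inter> Q = {}" "P \<union> Q = \<phi> ` V" "convex hull P \<inter> convex hull Q \<noteq> {}"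
    using Radon_partition[of "\<phi> ` V"] V by auto
  then obtain y where y: "y \<in> convex hull P" "y \<in> convex hull Q" by blast
  have sub: "P \<subseteq> mspace M" "Q \<subseteq> mspace M" using PQ image_mspace V by blast+
  have fin: "finite P" "finite Q" using PQ V by (metis finite_Un finite_imageI)+
  have "\<psi> y \<in> convex hull (\<psi> ` P) \<inter> convex hull (\<psi> ` Q)"
    using image_hull_subset(2) fin sub y by blast
  moreover have un: "\<psi> ` P \<union> \<psi> ` Q = V"
    using PQ(2) image_inverse(1)[OF V(2)] by (simp flip: image_Un)
  have "\<psi> ` P \<inter> \<psi> ` Q = \<psi> ` (P \<inter> Q)"
    using inj_on_mspace(2) sub by (simp add: inj_on_image_Int)
  then have "convex hull (\<psi> ` P) \<inter> convex hull (\<psi> ` Q) = {}"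
    using convex_hull_Int[of "\<psi> ` P" "\<psi> ` Q"] ind un PQ(1) by simp
  ultimately show False by blast
qed

lemma msimplex_vertices_image:
  assumes "msimplex_vertices M V"
  shows "msimplex_vertices M (\<phi> ` V)"
proof -
  have V: "finite V" "card V = CARD('n) + 1" "\<not> affine_dependent V" "V \<subseteq> mspace M"
    using assms by (auto simp: msimplex_vertices_def)
  moreover have "card (\<phi> ` V) = card V"
    using V inj_on_mspace(1) by (metis card_image inj_on_subset)
  ultimately show ?thesis
    using affine_independent_image image_mspace by (simp add: msimplex_vertices_def card_eq)
qed

lemma mregular_image:
  assumes "V \<subseteq> mspace M" shows "mregular M (\<phi> ` V) \<longleftrightarrow> mregular M V"
proof -
  have "\<phi> u = \<phi> v \<longleftrightarrow> u = v" "mdist M (\<phi> u) (\<phi> v) = mdist M u v" if "u \<in> V" "v \<in> V" for u v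
    using subsetD[OF assms that(1)] subsetD[OF assms that(2)] inj_on_mspace(1) mdist by (auto dest: inj_onD)
  then show ?thesis unfolding mregular_def by (simp add: ball_simps)
qed

lemma image_subset_hull_iff:
  assumes "finite V" "V \<subseteq> mspace M" "B \<subseteq> mspace M"
  shows "\<phi> ` B \<subseteq> convex hull (\<phi> ` V) \<longleftrightarrow> B \<subseteq> convex hull V"
  unfolding image_hull[OF assms(1,2), symmetric]
  using inj_on_mspace(1) assms(3) hull_subset_mspace[OF assms(2)] by (rule inj_on_image_subset_iff)

lemma circumscribed_image:
  assumes V: "finite V" "V \<subseteq> mspace M" "B \<subseteq> mspace M"
  shows "circumscribed (\<phi> ` B) (\<phi> ` V) \<longleftrightarrow> circumscribed B V"
proof -
  have "convex hull (\<phi> ` V - {\<phi> v}) \<inter> \<phi> ` B = \<phi> ` (convex hull (V - {v}) \<inter> B)" if v: "v \<in> V" for v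
  proof -
    have "\<phi> ` V - {\<phi> v} = \<phi> ` (V - {v})"
      using inj_on_mspace(1) V v by (subst inj_on_image_set_diff[of _ "mspace M"]) auto
    moreover have sub: "V - {v} \<subseteq> mspace M" using V by blast
    ultimately have "convex hull (\<phi> ` V - {\<phi> v}) = \<phi> ` (convex hull (V - {v}))"
      using image_hull[of "V - {v}"] V by simp
    then show ?thesis
      using inj_on_image_Int[OF inj_on_mspace(1) hull_subset_mspace[OF sub] V(3)] by simp
  qed
  then show ?thesis
    unfolding circumscribed_def image_subset_hull_iff[OF assms] by simp
qed

lemma image_mball:
  assumes "c \<in> mspace M"
  shows "\<phi> ` mball M c r = mball M (\<phi> c) r"
proof safe
  fix y assume y: "y \<in> mball M (\<phi> c) r"
  then have "y = \<phi> (\<psi> y)" "\<psi> y \<in> mspace M" using inverse maps by (auto simp: mball_def)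
  moreover have "mdist M c (\<psi> y) = mdist M (\<phi> c) y"
    using mdist[of c "\<psi> y"] calculation assms by simp
  ultimately show "y \<in> \<phi> ` mball M c r" using y by (intro image_eqI[of _ _ "\<psi> y"]) (auto simp: mball_def)
qed (use assms maps mdist in \<open>auto simp: mball_def\<close>)

lemma minimal_iff_regular_image:
  assumes V: "msimplex_vertices M V" and B: "B \<subseteq> mspace M"
    and im: "minimal_iff_regular M (\<phi> ` B) (\<phi> ` V)"
  shows "minimal_iff_regular M B V"
proof -
  interpret inv: model_isometry M \<psi> \<phi> by (rule symmetric)
  have V': "finite V" "V \<subseteq> mspace M" using V by (auto simp: msimplex_vertices_def)
  have vol: "mvol M (convex hull (\<phi> ` W)) = mvol M (convex hull W)" if "msimplex_vertices M W" for W
    using that image_hull[of W] mvol_image[of W] by (simp add: msimplex_vertices_def)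
  have "(\<forall>W. msimplex_vertices M W \<and> \<phi> ` B \<subseteq> convex hull W \<longrightarrow> mvol M (convex hull (\<phi> ` V)) \<le> mvol M (convex hull W))
    \<longleftrightarrow> (\<forall>W. msimplex_vertices M W \<and> B \<subseteq> convex hull W \<longrightarrow> mvol M (convex hull V) \<le> mvol M (convex hull W))"
    (is "?L \<longleftrightarrow> ?R")
  proof
    assume L: ?L
    show ?R
    proof (intro allI impI, elim conjE)
      fix W assume W: "msimplex_vertices M W" "B \<subseteq> convex hull W"
      then have "\<phi> ` B \<subseteq> convex hull (\<phi> ` W)"
        using image_subset_hull_iff B by (simp add: msimplex_vertices_def)
      then have "mvol M (convex hull (\<phi> ` V)) \<le> mvol M (convex hull (\<phi> ` W))"
        using L msimplex_vertices_image[OF W(1)] by blast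
      then show "mvol M (convex hull V) \<le> mvol M (convex hull W)" by (simp add: vol V W)
    qed
  next
    assume R: ?R
    show ?L
    proof (intro allI impI, elim conjE)
      fix W assume W: "msimplex_vertices M W" "\<phi> ` B \<subseteq> convex hull W"
      have W': "msimplex_vertices M (\<psi> ` W)" using W(1) by (rule inv.msimplex_vertices_image)
      have WW: "\<phi> ` \<psi> ` W = W" using W(1) image_inverse by (simp add: msimplex_vertices_def)
      have "B \<subseteq> convex hull (\<psi> ` W)"
        using image_subset_hull_iff[of "\<psi> ` W" B] W(2) W' B WW by (simp add: msimplex_vertices_def)
      with R W' have "mvol M (convex hull V) \<le> mvol M (convex hull (\<psi> ` W))" by blast
      then show "mvol M (convex hull (\<phi> ` V)) \<le> mvol M (convex hull W)"
        using vol[OF V] vol[OF W'] WW by simp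
    qed
  qed
  then show ?thesis
    using im unfolding minimal_iff_regular_def mregular_image[OF V'(2)] circumscribed_image[OF V' B] by blast
qed

end

section \<open>Coordinates with a well-ordered index type\<close>

text \<open>The change of variables theorems of the library need a well-ordered index type. This is a
  well-ordered copy of an arbitrary finite type.\<close>

typedef 'a index_copy = "{..<CARD('a::finite)}"
  by (rule exI[of _ 0]) simp

instance index_copy :: (finite) finite
proof
  have "finite (Rep_index_copy ` (UNIV :: 'a index_copy set))"
    by (metis type_definition.Rep_range[OF type_definition_index_copy] finite_lessThan)
  then show "finite (UNIV :: 'a index_copy set)"
    by (rule finite_imageD) (simp add: inj_def Rep_index_copy_inject)
qed

instantiation index_copy :: (finite) wellorder
begin

definition less_eq_index_copy :: "'a index_copy \<Rightarrow> 'a index_copy \<Rightarrow> bool" where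
  "x \<le> y \<longleftrightarrow> Rep_index_copy x \<le> Rep_index_copy y"

definition less_index_copy :: "'a index_copy \<Rightarrow> 'a index_copy \<Rightarrow> bool" where
  "x < y \<longleftrightarrow> Rep_index_copy x < Rep_index_copy y"

instance
proof
  fix P :: "'a index_copy \<Rightarrow> bool" and a
  assume step: "\<And>x. (\<And>y. y < x \<Longrightarrow> P y) \<Longrightarrow> P x"
  show "P a"
    by (induction a rule: measure_induct_rule[of Rep_index_copy]) (auto intro: step simp: less_index_copy_def)
qed (auto simp: less_eq_index_copy_def less_index_copy_def Rep_index_copy_inject)

end

lemma card_index_copy: "CARD('a::finite index_copy) = CARD('a)"
  using type_definition.card[OF type_definition_index_copy[where 'a = 'a]] by simp

lemma prod_Basis_vec: "(\<Prod>b\<in>Basis. (x::real^'n) \<bullet> b) = (\<Prod>i\<in>UNIV. x $ i)"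
proof -
  have "(Basis :: (real^'n) set) = range (\<lambda>i. axis i 1)" by (auto simp: Basis_vec_def)
  moreover have "inj (\<lambda>i. axis i 1 :: real^'n)" by (auto simp: inj_def axis_eq_axis)
  ultimately have "(\<Prod>b\<in>Basis. x \<bullet> b) = (\<Prod>i\<in>UNIV. x \<bullet> axis i 1)"
    using prod.reindex[of "\<lambda>i. axis i 1 :: real^'n" UNIV "\<lambda>b. x \<bullet> b"] by (simp only: o_def)
  then show ?thesis by (simp add: inner_axis)
qed

lemma borel_hull_finite:
  fixes S :: "(real^'n) set"
  assumes "finite S"
  shows "convex hull S \<in> sets borel"
  using assms by (intro borel_compact finite_imp_compact_convex_hull)

text \<open>Serves both the relabelling of coordinates and the rotations: the density sees only the
  norm and the dimension.\<close>

lemma model_isometry_linear: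
  fixes \<phi> :: "real^'n \<Rightarrow> real^'m" and \<psi> :: "real^'m \<Rightarrow> real^'n"
  assumes card: "CARD('n) = CARD('m)" and lin: "linear \<phi>" "linear \<psi>"
    and inner: "\<And>x y. \<phi> x \<bullet> \<phi> y = x \<bullet> y"
    and inv: "\<And>x. \<psi> (\<phi> x) = x" "\<And>y. \<phi> (\<psi> y) = y"
    and lborel: "distr lborel borel \<phi> = lborel"
  shows "model_isometry M \<phi> \<psi>"
proof
  have norm: "norm (\<phi> x) = norm x" for x by (simp add: norm_eq_sqrt_inner inner)
  have norm': "norm (\<psi> y) = norm y" for y using norm[of "\<psi> y"] by (simp add: inv)
  show "x \<in> mspace M \<Longrightarrow> \<phi> x \<in> mspace M" "y \<in> mspace M \<Longrightarrow> \<psi> y \<in> mspace M" for x y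
    by (cases M; simp add: mspace_def norm norm')+
  show "mdist M (\<phi> x) (\<phi> x') = mdist M x x'" for x x'
    using norm[of "x - x'"] by (cases M) (simp_all add: mdist_def norm inner dist_norm linear_diff[OF lin(1)])
  fix S :: "(real^'n) set" assume S: "finite S" "S \<subseteq> mspace M"
  have "\<phi> ` (convex hull S) = convex hull (\<phi> ` S)"
    using lin by (simp add: convex_hull_linear_image)
  then have im: "\<phi> ` (convex hull S) \<in> sets borel" using S borel_hull_finite[of "\<phi> ` S"] by simp
  have [measurable]: "\<phi> \<in> borel_measurable borel"
    using lin by (simp add: borel_measurable_continuous_onI linear_continuous_on linear_linear)
  have dens: "mdensity M (\<phi> x) = mdensity M x" for x
    by (cases M) (simp_all add: mdensity_def norm card)
  have [measurable]: "mdensity M \<in> borel_measurable (borel :: (real^'m) measure)"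
    by (cases M) (simp_all add: mdensity_def[abs_def])
  note [measurable] = im
  have "mvol M (\<phi> ` (convex hull S)) = (\<integral>\<^sup>+ y. indicator (\<phi> ` (convex hull S)) y * ennreal (mdensity M y) \<partial>distr lborel borel \<phi>)"
    unfolding lborel by (rule mvol_eq_mdensity) measurable
  also have "\<dots> = (\<integral>\<^sup>+ x. indicator (\<phi> ` (convex hull S)) (\<phi> x) * ennreal (mdensity M (\<phi> x)) \<partial>lborel)"
    by (rule nn_integral_distr) measurable
  also have "\<dots> = (\<integral>\<^sup>+ x. indicator (convex hull S) x * ennreal (mdensity M x) \<partial>lborel)"
  proof (rule nn_integral_cong)
    fix x
    have "\<phi> x \<in> \<phi> ` (convex hull S) \<longleftrightarrow> x \<in> convex hull S" by (metis imageE imageI inv(1))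
    then show "indicator (\<phi> ` (convex hull S)) (\<phi> x) * ennreal (mdensity M (\<phi> x))
      = indicator (convex hull S) x * ennreal (mdensity M x)"
      by (simp add: dens indicator_def)
  qed
  also have "\<dots> = mvol M (convex hull S)"
    by (rule mvol_eq_mdensity[symmetric]) (rule borel_hull_finite[OF S(1)])
  finally show "mvol M (\<phi> ` (convex hull S)) = mvol M (convex hull S)" .
qed (use lin inv card in \<open>auto simp: convex_hull_linear_image\<close>)

lemma model_isometry_index_copy:
  obtains \<phi> :: "real^'n \<Rightarrow> real^'n index_copy" and \<psi> where "model_isometry M \<phi> \<psi>"
proof -
  have "card (UNIV :: 'n index_copy set) = card (UNIV :: 'n set)" by (rule card_index_copy)
  then obtain e :: "'n index_copy \<Rightarrow> 'n" where e: "bij e"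
    using finite_same_card_bij[of "UNIV :: 'n index_copy set" "UNIV :: 'n set"] by auto
  define \<phi> :: "real^'n \<Rightarrow> real^'n index_copy" where "\<phi> x = (\<chi> i. x $ e i)" for x
  define \<psi> :: "real^'n index_copy \<Rightarrow> real^'n" where "\<psi> y = (\<chi> i. y $ inv e i)" for y
  have lin: "linear \<phi>" "linear \<psi>" unfolding \<phi>_def \<psi>_def by (auto intro!: linearI simp: vec_eq_iff)
  have inv: "\<psi> (\<phi> x) = x" "\<phi> (\<psi> y) = y" for x y
    using e by (auto simp: \<phi>_def \<psi>_def vec_eq_iff bij_is_inj bij_is_surj surj_f_inv_f inv_f_f)
  have inner: "\<phi> x \<bullet> \<phi> y = x \<bullet> y" for x y
    using sum.reindex_bij_betw[OF e, of "\<lambda>i. x $ i * y $ i"] by (simp add: \<phi>_def inner_vec_def)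
  have [measurable]: "\<phi> \<in> borel_measurable borel"
    using lin by (simp add: borel_measurable_continuous_onI linear_continuous_on linear_linear)
  have "lborel = distr lborel borel \<phi>"
  proof (rule lborel_eqI)
    fix l u :: "real^'n index_copy"
    assume le: "\<And>b. b \<in> Basis \<Longrightarrow> l \<bullet> b \<le> u \<bullet> b"
    then have le': "l $ i \<le> u $ i" for i by (force simp: Basis_vec_def inner_axis)
    have "\<phi> -` box l u = box (\<psi> l) (\<psi> u)"
    proof safe
      fix x assume "\<phi> x \<in> box l u"
      then have "l $ inv e i < x $ e (inv e i)" "x $ e (inv e i) < u $ inv e i" for i
        by (simp_all add: mem_box_cart \<phi>_def)
      then show "x \<in> box (\<psi> l) (\<psi> u)"
        using e by (simp add: mem_box_cart \<psi>_def bij_is_surj surj_f_inv_f)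
    next
      fix x assume "x \<in> box (\<psi> l) (\<psi> u)"
      then have "l $ inv e (e i) < x $ e i" "x $ e i < u $ inv e (e i)" for i
        by (simp_all add: mem_box_cart \<psi>_def)
      then show "x \<in> \<phi> -` box l u"
        using e by (simp add: mem_box_cart \<phi>_def bij_is_inj inv_f_f)
    qed
    then have "emeasure (distr lborel borel \<phi>) (box l u) = emeasure lborel (box (\<psi> l) (\<psi> u))"
      by (simp add: emeasure_distr)
    also have "\<dots> = ennreal (\<Prod>i\<in>UNIV. u $ inv e i - l $ inv e i)"
    proof -
      have "\<psi> l \<bullet> b \<le> \<psi> u \<bullet> b" if "b \<in> Basis" for b
        using that le' by (auto simp: \<psi>_def Basis_vec_def inner_axis)
      then show ?thesis
        by (simp add: emeasure_lborel_box prod_Basis_vec \<psi>_def)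
    qed
    also have "(\<Prod>i\<in>UNIV. u $ inv e i - l $ inv e i) = (\<Prod>i\<in>UNIV. u $ i - l $ i)"
      using prod.reindex_bij_betw[OF bij_imp_bij_inv[OF e], of "\<lambda>i. u $ i - l $ i"] by simp
    also have "ennreal \<dots> = (\<Prod>b\<in>Basis. (u - l) \<bullet> b)" by (simp add: prod_Basis_vec)
    finally show "emeasure (distr lborel borel \<phi>) (box l u) = (\<Prod>b\<in>Basis. (u - l) \<bullet> b)" .
  qed simp
  then have "model_isometry M \<phi> \<psi>"
    by (intro model_isometry_linear lin inner inv) (simp_all add: card_index_copy)
  then show thesis by (rule that)
qed

section \<open>Translations, rotations and boosts\<close>

lemma model_isometry_translation:
  fixes c :: "real^'n"
  shows "model_isometry Euclid (\<lambda>x. x - c) (\<lambda>x. x + c)"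
proof
  fix S :: "(real^'n) set" assume S: "finite S"
  have im: "(\<lambda>x. x - c) ` (convex hull T) = convex hull ((\<lambda>x. x - c) ` T)"
    "(\<lambda>x. x + c) ` (convex hull T) = convex hull ((\<lambda>x. x + c) ` T)" for T :: "(real^'n) set"
    using convex_hull_translation[of "-c" T] convex_hull_translation[of c T] by (simp_all add: add.commute)
  then show "(\<lambda>x. x - c) ` (convex hull S) \<subseteq> convex hull ((\<lambda>x. x - c) ` S)"
    "(\<lambda>x. x + c) ` (convex hull S) \<subseteq> convex hull ((\<lambda>x. x + c) ` S)" by blast+
  have b: "convex hull S \<in> sets borel" "(\<lambda>x. x - c) ` (convex hull S) \<in> sets borel"
    using S unfolding im by (simp_all add: borel_hull_finite)
  have "(\<lambda>x. x - c) ` (convex hull S) = (+) c -` (convex hull S)"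
    by (force simp: image_iff intro: bexI[of _ "c + _"])
  then have "emeasure lborel ((\<lambda>x. x - c) ` (convex hull S)) = emeasure (distr lborel borel ((+) c)) (convex hull S)"
    using b by (simp add: emeasure_distr)
  then show "mvol Euclid ((\<lambda>x. x - c) ` (convex hull S)) = mvol Euclid (convex hull S)"
    using b by (simp add: mvol_def lborel_distr_plus)
qed (auto simp: mspace_def mdist_def dist_norm)

lemma model_isometry_orthogonal:
  fixes Q :: "real^'m::{finite,wellorder} \<Rightarrow> real^'m::_"
  assumes Q: "orthogonal_transformation Q"
  shows "model_isometry M Q (inv Q)"
proof (rule model_isometry_linear)
  show "linear Q" "linear (inv Q)"
    using orthogonal_transformation_linear[OF Q]
      orthogonal_transformation_linear[OF orthogonal_transformation_inv[OF Q]] by simp_all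
  show "distr lborel borel Q = lborel"
    using preserves_lborel_orthogonal[OF Q] by (simp add: preserves_lborel_def)
  show "inv Q (Q x) = x" "Q (inv Q x) = x" for x
    using orthogonal_transformation_bij[OF Q] by (simp_all add: bij_is_inj bij_is_surj surj_f_inv_f)
  show "Q x \<bullet> Q y = x \<bullet> y" for x y using Q by (simp add: orthogonal_transformation_def)
qed simp

text \<open>A point at hyperbolic distance \<open>t\<close> from the origin satisfies
  \<open>cosh t = 1 / sqrt (1 - (norm x)\<^sup>2)\<close>, that is, it has Euclidean norm
  \<open>tanh t\<close>.\<close>

lemma mball_Hyp_0:
  fixes r :: real
  assumes "r > 0"
  shows "mball Hyp (0 :: real^'n) r = cball 0 (tanh r)"
proof -
  have iff: "norm x < 1 \<and> mdist Hyp 0 x \<le> r \<longleftrightarrow> norm x \<le> tanh r" for x :: "real^'n"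
  proof (cases "norm x < 1")
    case True
    then have pos: "0 < 1 - (norm x)\<^sup>2" by (simp add: abs_square_less_1)
    define t where "t = arcosh (1 / sqrt (1 - (norm x)\<^sup>2))"
    have "1 \<le> 1 / sqrt (1 - (norm x)\<^sup>2)" using pos by simp
    then have t0: "t \<ge> 0" and c: "cosh t = 1 / sqrt (1 - (norm x)\<^sup>2)" by (simp_all add: t_def)
    have "(tanh t)\<^sup>2 = 1 - 1 / (cosh t)\<^sup>2"
    proof -
      have "(tanh t)\<^sup>2 = (sinh t)\<^sup>2 / (cosh t)\<^sup>2" by (simp add: tanh_def power_divide)
      also have "(sinh t)\<^sup>2 = (cosh t)\<^sup>2 - 1" using cosh_square_eq[of t] by simp
      finally show ?thesis using cosh_real_pos[of t] by (simp only: diff_divide_distrib) simp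
    qed
    also have "\<dots> = (norm x)\<^sup>2" using pos by (simp add: c power_divide)
    finally have "(norm x)\<^sup>2 = (tanh t)\<^sup>2" by (rule sym)
    then have t: "norm x = tanh t" using t0 by (simp add: power2_eq_imp_eq)
    have "mdist Hyp 0 x = t" by (simp add: mdist_def t_def)
    with True t show ?thesis by simp
  next
    case False
    then show ?thesis using tanh_real_lt_1[of r] by linarith
  qed
  have mem: "x \<in> mball Hyp 0 r \<longleftrightarrow> norm x < 1 \<and> mdist Hyp 0 x \<le> r" for x :: "real^'n"
    by (simp add: mball_def mspace_def)
  show ?thesis by (rule set_eqI) (simp only: mem iff mem_cball_0)
qed

section \<open>The hyperbolic boost and its change of variables\<close>

text \<open>In the Leibniz sum only the identity survives: off the diagonal nonzero entries occur
  only in column \<open>k\<close>, and a permutation using one of them there must also use a zero in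
  row \<open>k\<close>.\<close>

lemma det_scalar_plus_column:
  fixes u :: "real^'n"
  assumes A: "\<And>i j. A $ i $ j = (if i = j then c else 0) + (if j = k then u $ i else 0)"
  shows "det (A :: real^'n^'n) = c ^ (CARD('n) - 1) * (c + u $ k)"
proof -
  let ?PU = "{p. p permutes (UNIV :: 'n set)}"
  have "det A = (\<Sum>p\<in>?PU. of_int (sign p) * (\<Prod>i\<in>UNIV. A $ i $ p i))"
    by (simp add: det_def)
  also have "\<dots> = (\<Sum>p\<in>{id}. of_int (sign p) * (\<Prod>i\<in>UNIV. A $ i $ p i))"
  proof (rule sum.mono_neutral_right)
    show "finite ?PU" by (simp add: finite_permutations)
    show "{id} \<subseteq> ?PU" by (auto simp: permutes_id)
    show "\<forall>p\<in>?PU - {id}. of_int (sign p) * (\<Prod>i\<in>UNIV. A $ i $ p i) = 0"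
    proof
      fix p assume p: "p \<in> ?PU - {id}"
      then have "inj p" using permutes_inj by auto
      from p obtain i where i: "p i \<noteq> i" by fastforce
      have "\<exists>i. A $ i $ p i = 0"
      proof (cases "p i = k")
        case True
        then have "p k \<noteq> k" using i \<open>inj p\<close> by (metis injD)
        then show ?thesis by (intro exI[of _ k]) (simp add: A)
      next
        case False
        then show ?thesis using i by (intro exI[of _ i]) (simp add: A)
      qed
      then have "(\<Prod>i\<in>UNIV. A $ i $ p i) = 0" by (auto intro: prod_zero)
      then show "of_int (sign p) * (\<Prod>i\<in>UNIV. A $ i $ p i) = 0" by simp
    qed
  qed
  also have "\<dots> = (\<Prod>i\<in>UNIV. A $ i $ i)" by (simp add: sign_id)
  also have "\<dots> = A $ k $ k * (\<Prod>i\<in>UNIV - {k}. A $ i $ i)" by (simp add: prod.remove[of UNIV k])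
  also have "(\<Prod>i\<in>UNIV - {k}. A $ i $ i) = (\<Prod>i\<in>UNIV - {k}. c)" by (intro prod.cong) (auto simp: A)
  finally show ?thesis by (simp add: A card_Diff_singleton)
qed

text \<open>Bridge from the nonnegative integral defining \<open>mvol\<close> to the real-valued
  integral in which the change of variables is carried out.\<close>

lemma mdensity_has_integral:
  fixes S :: "(real^'m::{finite,wellorder}) set"
  assumes S: "S \<in> sets borel" and R: "S \<subseteq> cball 0 R" "M = Hyp \<Longrightarrow> R < 1"
  shows "mvol M S < \<infinity>" "(mdensity M has_integral enn2real (mvol M S)) S"
proof -
  interpret radial_density "mdensity M :: real^'m::_ \<Rightarrow> real" R
    using R(2) by (rule radial_density_mdensity)
  have vol: "mvol M S = vol S" using S by (simp add: mvol_eq_mdensity vol_def)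
  show fin: "mvol M S < \<infinity>" unfolding vol using R(1) by (rule vol_finite)
  have nn: "0 \<le> mdensity M x" for x :: "real^'m::_" by (cases M) (simp_all add: mdensity_def)
  have "((\<lambda>x. indicator S x * mdensity M x) has_integral enn2real (mvol M S)) UNIV"
  proof (rule nn_integral_has_integral)
    show "(\<lambda>x. indicator S x * mdensity M x) \<in> borel_measurable borel" using S by measurable
    have "(\<integral>\<^sup>+ x. ennreal (indicator S x * mdensity M x) \<partial>lborel) = mvol M S"
      unfolding vol vol_def by (intro nn_integral_cong) (simp add: indicator_def)
    then show "(\<integral>\<^sup>+ x. ennreal (indicator S x * mdensity M x) \<partial>lborel) = ennreal (enn2real (mvol M S))"
      using fin by simp
  qed (simp_all add: nn)
  then show "(mdensity M has_integral enn2real (mvol M S)) S"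
    by (subst (asm) has_integral_cong[of _ _ "\<lambda>x. if x \<in> S then mdensity M x else 0"])
      (auto simp: indicator_def has_integral_restrict_UNIV)
qed

text \<open>In the hyperboloid model this is the Lorentz reflection that exchanges the points over the origin
  and \<open>a *\<^sub>R e\<close>.\<close>

definition klein_boost :: "real \<Rightarrow> real^'m \<Rightarrow> real^'m \<Rightarrow> real^'m" where
  "klein_boost a e x = (1 / (1 - a * (e \<bullet> x))) *\<^sub>R
     (sqrt (1 - a\<^sup>2) *\<^sub>R x + (a - (1 + sqrt (1 - a\<^sup>2)) * (e \<bullet> x)) *\<^sub>R e)"

context
  fixes a :: real and e :: "real^'m"
  assumes a: "0 \<le> a" "a < 1" and e: "norm e = 1"
begin

private definition s where "s = sqrt (1 - a\<^sup>2)"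
private definition q where "q x = 1 - a * (e \<bullet> x)" for x

private lemma s: "0 < s" "s * s = 1 - a * a"
proof -
  have "a\<^sup>2 < 1" using a by (simp add: abs_square_less_1)
  then show "0 < s" "s * s = 1 - a * a" by (simp_all add: s_def flip: power2_eq_square)
qed

private lemma ee: "e \<bullet> e = 1"
  using e by (simp add: dot_square_norm)

private lemma q_pos: assumes "norm x < 1" shows "0 < q x"
proof -
  have "a * (e \<bullet> x) \<le> a * \<bar>e \<bullet> x\<bar>" using a by (intro mult_left_mono) auto
  also have "\<dots> \<le> 1 * \<bar>e \<bullet> x\<bar>" using a by (intro mult_right_mono) auto
  also have "\<dots> \<le> norm e * norm x" using Cauchy_Schwarz_ineq2[of e x] by simp
  finally show ?thesis using assms e by (simp add: q_def)
qed

private lemma boost_eq: "klein_boost a e x = (1 / q x) *\<^sub>R (s *\<^sub>R x + (a - (1 + s) * (e \<bullet> x)) *\<^sub>R e)"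
  by (simp add: klein_boost_def q_def s_def)

text \<open>The denominator and the numerator of the boost are the components of a linear map
  applied to \<open>(1, x)\<close> that multiplies the Lorentz form by \<open>1 - a\<^sup>2\<close>.
  Distances, invariance of the ball and the change of density all follow from this formula.\<close>

lemma klein_boost_inner:
  assumes "norm x < 1" "norm y < 1"
  shows "1 - klein_boost a e x \<bullet> klein_boost a e y
    = (1 - a\<^sup>2) * (1 - x \<bullet> y) / ((1 - a * (e \<bullet> x)) * (1 - a * (e \<bullet> y)))"
proof -
  have "(s *\<^sub>R x + (a - (1 + s) * (e \<bullet> x)) *\<^sub>R e) \<bullet> (s *\<^sub>R y + (a - (1 + s) * (e \<bullet> y)) *\<^sub>R e)
     = (s * s) * (x \<bullet> y) + (a * a - a * (e \<bullet> x) - a * (e \<bullet> y) + (1 - s * s) * ((e \<bullet> x) * (e \<bullet> y)))"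
    by (simp add: inner_add_left inner_add_right ee inner_commute algebra_simps)
  also have "\<dots> = q x * q y - (1 - a * a) * (1 - x \<bullet> y)"
    by (simp only: s(2)) (simp add: q_def algebra_simps)
  finally have N: "(s *\<^sub>R x + (a - (1 + s) * (e \<bullet> x)) *\<^sub>R e) \<bullet> (s *\<^sub>R y + (a - (1 + s) * (e \<bullet> y)) *\<^sub>R e)
    = q x * q y - (1 - a * a) * (1 - x \<bullet> y)" .
  have "klein_boost a e x \<bullet> klein_boost a e y = (q x * q y - (1 - a * a) * (1 - x \<bullet> y)) / (q x * q y)"
    by (simp add: boost_eq N[symmetric])
  then show ?thesis
    using q_pos[OF assms(1)] q_pos[OF assms(2)]
    by (simp add: diff_divide_distrib power2_eq_square flip: q_def)
qed

lemma klein_boost_norm: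
  assumes "norm x < 1"
  shows "1 - (norm (klein_boost a e x))\<^sup>2 = (1 - a\<^sup>2) * (1 - (norm x)\<^sup>2) / (1 - a * (e \<bullet> x))\<^sup>2"
  unfolding power2_norm_eq_inner klein_boost_inner[OF assms assms] by (simp add: power2_eq_square)

lemma klein_boost_in_ball:
  assumes "norm x < 1" shows "norm (klein_boost a e x) < 1"
proof -
  have "0 < (1 - a\<^sup>2) * (1 - (norm x)\<^sup>2) / (1 - a * (e \<bullet> x))\<^sup>2"
    using a assms q_pos[OF assms] by (intro divide_pos_pos mult_pos_pos) (auto simp: q_def abs_square_less_1)
  then show ?thesis
    unfolding klein_boost_norm[OF assms, symmetric] by (simp add: abs_square_less_1)
qed

lemma klein_boost_involution:
  assumes "norm x < 1" shows "klein_boost a e (klein_boost a e x) = x"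
proof -
  let ?y = "klein_boost a e x"
  have q: "q x > 0" using q_pos[OF assms] .
  have ey: "e \<bullet> ?y = (a - e \<bullet> x) / q x"
  proof -
    have "e \<bullet> ?y = (1 / q x) * (s * (e \<bullet> x) + (a - (1 + s) * (e \<bullet> x)))"
      by (simp add: boost_eq inner_add_right ee)
    also have "s * (e \<bullet> x) + (a - (1 + s) * (e \<bullet> x)) = a - e \<bullet> x" by (simp add: algebra_simps)
    finally show ?thesis by simp
  qed
  have qy: "q ?y = s * s / q x"
    unfolding q_def[of ?y] ey s(2) using q by (simp add: field_simps) (simp add: q_def algebra_simps)
  have "a - (1 + s) * (e \<bullet> ?y) = s * ((s + 1) * (e \<bullet> x) - a) / q x"
  proof -
    have "q x * (a - (1 + s) * (e \<bullet> ?y)) = a * q x - (1 + s) * (a - e \<bullet> x)"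
      using q by (simp add: ey field_simps)
    also have "\<dots> = (1 - a * a) * (e \<bullet> x) + s * (e \<bullet> x) - s * a" by (simp add: q_def algebra_simps)
    also have "\<dots> = s * ((s + 1) * (e \<bullet> x) - a)" by (simp only: s(2)[symmetric]) (simp add: algebra_simps)
    finally show ?thesis using q by (simp add: field_simps)
  qed
  then have "s *\<^sub>R ?y + (a - (1 + s) * (e \<bullet> ?y)) *\<^sub>R e = (s * s / q x) *\<^sub>R x"
    by (simp only:) (simp add: boost_eq[of x] vec_eq_iff add_divide_distrib diff_divide_distrib algebra_simps)
  then show ?thesis using q s(1) unfolding boost_eq[of ?y] qy by simp
qed

lemma klein_boost_center: "klein_boost a e (a *\<^sub>R e) = 0"
proof -
  have "s * a + (a - (1 + s) * a) = 0" by (simp add: algebra_simps)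
  then show ?thesis by (simp add: boost_eq ee flip: scaleR_add_left)
qed

text \<open>A projective map with positive denominator takes segments to segments: the weights
  \<open>u\<close> and \<open>v\<close> are multiplied by the denominators at \<open>x\<close> and
  \<open>y\<close> and divided by that at \<open>?z\<close>, which is their weighted mean.\<close>

lemma klein_boost_image_hull_subset:
  assumes S: "S \<subseteq> ball 0 1"
  shows "klein_boost a e ` (convex hull S) \<subseteq> convex hull (klein_boost a e ` S)"
proof -
  let ?h = "klein_boost a e" and ?C = "convex hull (klein_boost a e ` S)"
  have "convex {x. norm x < 1 \<and> ?h x \<in> ?C}"
  proof (rule convexI, safe)
    fix x y u v assume x: "norm x < 1" "?h x \<in> ?C" and y: "norm y < 1" "?h y \<in> ?C"
      and uv: "0 \<le> u" "0 \<le> v" "u + v = (1::real)"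
    let ?z = "u *\<^sub>R x + v *\<^sub>R y"
    have "?z \<in> ball 0 1"
      using x y uv by (intro convexD[OF convex_ball]) auto
    then show z: "norm ?z < 1" by simp
    have qx: "q x > 0" "q y > 0" "q ?z > 0" using q_pos x y z by auto
    have qz: "q ?z = u * q x + v * q y"
    proof -
      have "q ?z = (u + v) - a * (e \<bullet> ?z)" using uv by (simp add: q_def)
      then show ?thesis by (simp add: q_def inner_add_right algebra_simps)
    qed
    have hx: "s *\<^sub>R x + (a - (1 + s) * (e \<bullet> x)) *\<^sub>R e = q x *\<^sub>R ?h x" if "q x > 0" for x
      using that by (simp add: boost_eq)
    have "s *\<^sub>R ?z + ((u + v) * a - (1 + s) * (e \<bullet> ?z)) *\<^sub>R e
       = u *\<^sub>R (s *\<^sub>R x + (a - (1 + s) * (e \<bullet> x)) *\<^sub>R e) + v *\<^sub>R (s *\<^sub>R y + (a - (1 + s) * (e \<bullet> y)) *\<^sub>R e)"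
      by (simp add: inner_add_right algebra_simps)
    then have "?h ?z = (1 / q ?z) *\<^sub>R (u *\<^sub>R (q x *\<^sub>R ?h x) + v *\<^sub>R (q y *\<^sub>R ?h y))"
      using uv by (simp add: boost_eq[of ?z] hx[OF qx(1)] hx[OF qx(2)])
    also have "\<dots> = (u * q x / q ?z) *\<^sub>R ?h x + (v * q y / q ?z) *\<^sub>R ?h y"
      by (simp add: scaleR_add_right)
    also have "\<dots> \<in> ?C"
    proof (rule convexD[OF convex_convex_hull x(2) y(2)])
      show "u * q x / q ?z + v * q y / q ?z = 1"
        unfolding add_divide_distrib[symmetric] qz[symmetric] using qx by simp
    qed (use uv qx in auto)
    finally show "?h ?z \<in> ?C" .
  qed
  moreover have "S \<subseteq> {x. norm x < 1 \<and> ?h x \<in> ?C}" using S by (auto intro: hull_inc)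
  ultimately have "convex hull S \<subseteq> {x. norm x < 1 \<and> ?h x \<in> ?C}" by (rule hull_minimal[rotated])
  then show ?thesis by blast
qed

lemma klein_boost_image_subset:
  assumes "S \<subseteq> ball 0 1" shows "klein_boost a e ` S \<subseteq> ball 0 1" "klein_boost a e ` klein_boost a e ` S = S"
  using assms klein_boost_in_ball klein_boost_involution by (force simp: image_image)+

lemma klein_boost_image_hull:
  assumes S: "S \<subseteq> ball 0 1"
  shows "klein_boost a e ` (convex hull S) = convex hull (klein_boost a e ` S)"
proof
  let ?h = "klein_boost a e"
  note hS = klein_boost_image_subset[OF S]
  show "?h ` (convex hull S) \<subseteq> convex hull (?h ` S)" using klein_boost_image_hull_subset[OF S] .
  have "convex hull (?h ` S) \<subseteq> ball 0 1" using hS(1) by (rule hull_minimal) (rule convex_ball)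
  from klein_boost_image_subset(2)[OF this]
  have "convex hull (?h ` S) = ?h ` ?h ` (convex hull (?h ` S))" ..
  also have "\<dots> \<subseteq> ?h ` (convex hull S)"
    using klein_boost_image_hull_subset[OF hS(1)] hS(2) by (intro image_mono) simp
  finally show "convex hull (?h ` S) \<subseteq> ?h ` (convex hull S)" .
qed

text \<open>The quotient rule, sorted into a multiple of the identity plus a rank-one part that sees
  only \<open>e \<bullet> v\<close>; for a coordinate direction \<open>e\<close> this part is a
  single column.\<close>

lemma klein_boost_has_derivative:
  assumes "norm x < 1"
  shows "(klein_boost a e has_derivative
     (\<lambda>v. (s / q x) *\<^sub>R v + (e \<bullet> v) *\<^sub>R ((a / (q x)\<^sup>2) *\<^sub>R (s *\<^sub>R x + (a - (1 + s) * (e \<bullet> x)) *\<^sub>R e) - ((1 + s) / q x) *\<^sub>R e))) (at x within T)"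
proof -
  let ?N = "\<lambda>x. s *\<^sub>R x + (a - (1 + s) * (e \<bullet> x)) *\<^sub>R e"
  have "q x \<noteq> 0" using q_pos[OF assms] by simp
  then have "((\<lambda>x. 1 / q x) has_derivative (\<lambda>v. a * (e \<bullet> v) / (q x)\<^sup>2)) (at x within T)"
    unfolding q_def by (auto intro!: derivative_eq_intros simp: power2_eq_square)
  moreover have "(?N has_derivative (\<lambda>v. s *\<^sub>R v + (- ((1 + s) * (e \<bullet> v))) *\<^sub>R e)) (at x within T)"
    by (auto intro!: derivative_eq_intros)
  ultimately have "((\<lambda>x. (1 / q x) *\<^sub>R ?N x) has_derivative
     (\<lambda>v. (1 / q x) *\<^sub>R (s *\<^sub>R v + (- ((1 + s) * (e \<bullet> v))) *\<^sub>R e) + (a * (e \<bullet> v) / (q x)\<^sup>2) *\<^sub>R ?N x)) (at x within T)"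
    by (rule has_derivative_scaleR)
  then show ?thesis
    unfolding boost_eq[abs_def]
    by (rule has_derivative_eq_rhs)
      (simp add: fun_eq_iff vec_eq_iff add_divide_distrib algebra_simps)
qed

lemma klein_boost_jacobian:
  assumes x: "norm x < 1" and k: "e = axis k 1"
  obtains D where "(klein_boost a e has_derivative D) (at x within T)"
    "\<bar>det (matrix D)\<bar> = (sqrt (1 - a\<^sup>2) / (1 - a * (e \<bullet> x))) ^ (CARD('m) + 1)"
proof -
  define u where "u = (a / (q x)\<^sup>2) *\<^sub>R (s *\<^sub>R x + (a - (1 + s) * (e \<bullet> x)) *\<^sub>R e) - ((1 + s) / q x) *\<^sub>R e"
  define D where "D v = (s / q x) *\<^sub>R v + (e \<bullet> v) *\<^sub>R u" for v
  have q: "q x > 0" using x by (rule q_pos)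
  have "matrix D $ i $ j = (if i = j then s / q x else 0) + (if j = k then u $ i else 0)" for i j
  proof -
    have "e \<bullet> axis j 1 = (if j = k then 1 else 0)" by (simp add: k inner_axis_axis)
    moreover have "axis j (1::real) $ i = (if i = j then 1 else 0)" by (simp add: axis_def)
    ultimately show ?thesis by (simp add: matrix_def D_def)
  qed
  then have det: "det (matrix D) = (s / q x) ^ (CARD('m) - 1) * (s / q x + u $ k)"
    by (rule det_scalar_plus_column)
  have "u $ k = e \<bullet> u" by (simp add: k inner_axis inner_commute)
  also have "\<dots> = (a / (q x)\<^sup>2) * (s * (e \<bullet> x) + (a - (1 + s) * (e \<bullet> x))) - (1 + s) / q x"
    by (simp add: u_def inner_diff_right inner_add_right ee)
  also have "s * (e \<bullet> x) + (a - (1 + s) * (e \<bullet> x)) = a - e \<bullet> x" by (simp add: algebra_simps)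
  finally have "s / q x + u $ k = (a * (a - e \<bullet> x) - q x) / (q x)\<^sup>2"
    using q by (simp add: field_simps power2_eq_square)
  \<comment> \<open>The last factor becomes \<open>- (s / q x)\<^sup>2\<close>: it contributes two
    powers to the other \<open>CARD('m) - 1\<close>, and its sign shows that orientation is
    reversed.\<close>
  also have "a * (a - e \<bullet> x) - q x = - (s * s)" unfolding s(2) by (simp add: q_def algebra_simps)
  finally have "s / q x + u $ k = - (s / q x)\<^sup>2" by (simp add: power2_eq_square)
  then have "\<bar>det (matrix D)\<bar> = (s / q x) ^ (CARD('m) - 1) * (s / q x)\<^sup>2"
    using det s(1) q by (simp add: abs_mult)
  also have "\<dots> = (s / q x) ^ (CARD('m) - 1 + 2)" by (rule power_add[symmetric])
  also have "CARD('m) - 1 + 2 = CARD('m) + 1" by simp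
  finally show ?thesis
    using that[of D] klein_boost_has_derivative[OF x, of T] by (simp add: D_def[abs_def] u_def s_def q_def)
qed

text \<open>With \<open>t = s / q x\<close> the quantity \<open>1 - (norm x)\<^sup>2\<close> is
  multiplied by \<open>t\<^sup>2\<close>, so the exponent of the density yields
  \<open>CARD('m) + 1\<close> inverse powers of \<open>t\<close>, exactly offset by the
  Jacobian.\<close>

lemma klein_boost_density:
  assumes x: "norm x < 1"
  shows "(sqrt (1 - a\<^sup>2) / (1 - a * (e \<bullet> x))) ^ (CARD('m) + 1) * mdensity Hyp (klein_boost a e x) = mdensity Hyp x"
proof -
  define t where "t = s / q x"
  have t: "t > 0" using s(1) q_pos[OF x] by (simp add: t_def)
  have x2: "0 < 1 - (norm x)\<^sup>2" using x by (simp add: abs_square_less_1)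
  define n where "n = real CARD('m) + 1"
  have "1 - (norm (klein_boost a e x))\<^sup>2 = (s * s) * (1 - (norm x)\<^sup>2) / (q x)\<^sup>2"
    unfolding klein_boost_norm[OF x] s(2) by (simp add: q_def power2_eq_square)
  also have "\<dots> = t\<^sup>2 * (1 - (norm x)\<^sup>2)" by (simp add: t_def power2_eq_square)
  finally have "mdensity Hyp (klein_boost a e x) = (t\<^sup>2 * (1 - (norm x)\<^sup>2)) powr (- n / 2)"
    by (simp add: mdensity_def n_def)
  also have "\<dots> = (t\<^sup>2) powr (- n / 2) * mdensity Hyp x"
    using x2 by (simp add: powr_mult mdensity_def n_def)
  also have "(t\<^sup>2) powr (- n / 2) = t powr (- n)"
    using t by (simp add: powr_powr flip: powr_numeral)
  finally have "t powr n * mdensity Hyp (klein_boost a e x) = mdensity Hyp x"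
    using t by (simp add: powr_minus field_simps)
  moreover have "t powr n = t ^ (CARD('m) + 1)"
    using t powr_realpow[of t "CARD('m) + 1"] by (simp add: n_def add.commute)
  ultimately show ?thesis by (simp add: t_def s_def q_def)
qed

end

text \<open>A one-sided bound, from the integral estimate for images; the involution turns it into
  equality when it is applied to the image simplex.\<close>

lemma mvol_klein_boost_le:
  fixes e :: "real^'m::{finite,wellorder}"
  assumes a: "0 \<le> a" "a < 1" and e: "e = axis k 1" and S: "finite S" "S \<subseteq> ball 0 1"
  shows "mvol Hyp (klein_boost a e ` (convex hull S)) \<le> mvol Hyp (convex hull S)"
proof (cases "S = {}")
  case False
  have ne: "norm e = 1" by (simp add: e)
  let ?h = "klein_boost a e" and ?S = "convex hull S"
  have sub: "?S \<subseteq> ball 0 1" using S(2) by (rule hull_minimal) (rule convex_ball)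
  have hsub: "?h ` S \<subseteq> ball 0 1" using klein_boost_image_subset(1)[OF a ne S(2)] .
  have im: "?h ` ?S = convex hull (?h ` S)" using klein_boost_image_hull[OF a ne S(2)] .
  have int: "mvol Hyp (convex hull T) < \<infinity>"
    "((mdensity Hyp :: real^'m::_ \<Rightarrow> real) has_integral enn2real (mvol Hyp (convex hull T))) (convex hull T)"
    if T: "finite T" "T \<noteq> {}" "T \<subseteq> ball 0 1" for T :: "(real^'m::_) set"
  proof -
    have "Max (norm ` T) < 1" using T by auto
    moreover have "convex hull T \<subseteq> cball 0 (Max (norm ` T))"
      using T by (intro hull_minimal) auto
    ultimately show "mvol Hyp (convex hull T) < \<infinity>"
      "((mdensity Hyp :: real^'m::_ \<Rightarrow> real) has_integral enn2real (mvol Hyp (convex hull T))) (convex hull T)"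
      using mdensity_has_integral[OF borel_hull_finite[OF T(1)]] by blast+
  qed
  note intS = int[OF S(1) False S(2)]
  have intH: "mvol Hyp (?h ` ?S) < \<infinity>"
    "(mdensity Hyp has_integral enn2real (mvol Hyp (?h ` ?S))) (?h ` ?S)"
    using int[of "?h ` S"] S False hsub unfolding im by auto
  have "\<forall>x\<in>?S. \<exists>D. (?h has_derivative D) (at x within ?S) \<and>
    \<bar>det (matrix D)\<bar> = (sqrt (1 - a\<^sup>2) / (1 - a * (e \<bullet> x))) ^ (CARD('m) + 1)"
  proof
    fix x assume "x \<in> ?S"
    then have "norm x < 1" using sub by auto
    from klein_boost_jacobian[OF a ne this e, of ?S]
    show "\<exists>D. (?h has_derivative D) (at x within ?S) \<and>
      \<bar>det (matrix D)\<bar> = (sqrt (1 - a\<^sup>2) / (1 - a * (e \<bullet> x))) ^ (CARD('m) + 1)" by blast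
  qed
  then obtain D where D: "\<And>x. x \<in> ?S \<Longrightarrow> (?h has_derivative D x) (at x within ?S)"
    "\<And>x. x \<in> ?S \<Longrightarrow> \<bar>det (matrix (D x))\<bar> = (sqrt (1 - a\<^sup>2) / (1 - a * (e \<bullet> x))) ^ (CARD('m) + 1)"
    unfolding Ball_def by metis
  have dens: "\<bar>det (matrix (D x))\<bar> * mdensity Hyp (?h x) = mdensity Hyp x" if "x \<in> ?S" for x
    using that sub klein_boost_density[OF a ne, of x] D(2)[OF that] by auto
  have "integral (?h ` ?S) (mdensity Hyp) \<le> integral ?S (\<lambda>x. \<bar>det (matrix (D x))\<bar> * mdensity Hyp (?h x))"
  proof (rule integral_on_image_ubound)
    show "(\<lambda>x. \<bar>det (matrix (D x))\<bar> * mdensity Hyp (?h x)) integrable_on ?S"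
      using intS(2) dens by (subst integrable_cong[of _ _ "mdensity Hyp"]) (auto simp: integrable_on_def)
  qed (use D in \<open>auto simp: mdensity_def\<close>)
  also have "\<dots> = integral ?S (mdensity Hyp)"
    by (rule integral_cong) (rule dens)
  finally have "enn2real (mvol Hyp (?h ` ?S)) \<le> enn2real (mvol Hyp ?S)"
    using intS(2) intH(2) by (simp add: integral_unique)
  then show ?thesis using intS(1) intH(1) by (metis enn2real_nonneg ennreal_enn2real ennreal_leI infinity_ennreal_def)
qed simp

lemma model_isometry_klein_boost:
  fixes e :: "real^'m::{finite,wellorder}"
  assumes a: "0 \<le> a" "a < 1" and e: "e = axis k 1"
  shows "model_isometry Hyp (klein_boost a e) (klein_boost a e)"
proof -
  have ne: "norm e = 1" by (simp add: e)
  let ?h = "klein_boost a e"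
  note boost = klein_boost_involution[OF a ne] klein_boost_in_ball[OF a ne]
  have hull: "?h ` (convex hull S) \<subseteq> convex hull (?h ` S)" if "S \<subseteq> ball 0 1" for S
    using klein_boost_image_hull_subset[OF a ne that] .
  show ?thesis
  proof
    fix x y :: "real^'m::_" assume "x \<in> mspace Hyp" "y \<in> mspace Hyp"
    then have xy: "norm x < 1" "norm y < 1" by (auto simp: mspace_def)
    have q: "0 < 1 - a * (e \<bullet> z)" if "norm z < 1" for z
    proof -
      have "\<bar>e \<bullet> z\<bar> < 1" using Cauchy_Schwarz_ineq2[of e z] ne that by simp
      then have "a * (e \<bullet> z) \<le> a * 1" using a by (intro mult_left_mono) auto
      then show ?thesis using a by simp
    qed
    define s where "s = 1 - a\<^sup>2"
    have s: "s > 0" using a by (simp add: s_def abs_square_less_1)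
    define p where "p z = 1 - a * (e \<bullet> z)" for z
    have p: "p x > 0" "p y > 0" using q xy by (simp_all add: p_def)
    define g where "g = s / (p x * p y)"
    have g: "g > 0" using s p by (simp add: g_def)
    have "sqrt ((1 - (norm (?h x))\<^sup>2) * (1 - (norm (?h y))\<^sup>2))
      = sqrt (g\<^sup>2 * ((1 - (norm x)\<^sup>2) * (1 - (norm y)\<^sup>2)))"
      unfolding klein_boost_norm[OF a ne xy(1)] klein_boost_norm[OF a ne xy(2)]
      by (simp add: g_def s_def p_def power2_eq_square mult_ac)
    also have "\<dots> = g * sqrt ((1 - (norm x)\<^sup>2) * (1 - (norm y)\<^sup>2))"
      using g by (subst real_sqrt_mult) simp
    finally have n: "sqrt ((1 - (norm (?h x))\<^sup>2) * (1 - (norm (?h y))\<^sup>2))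
      = g * sqrt ((1 - (norm x)\<^sup>2) * (1 - (norm y)\<^sup>2))" .
    have "1 - ?h x \<bullet> ?h y = g * (1 - x \<bullet> y)"
      unfolding klein_boost_inner[OF a ne xy] by (simp add: g_def s_def p_def)
    moreover have "g \<noteq> 0" using g by simp
    ultimately show "mdist Hyp (?h x) (?h y) = mdist Hyp x y"
      unfolding mdist_def n by simp
  next
    fix S :: "(real^'m::_) set" assume S: "finite S" "S \<subseteq> mspace Hyp"
    then have S1: "S \<subseteq> ball 0 1" by (simp add: mspace_def)
    show "?h ` (convex hull S) \<subseteq> convex hull (?h ` S)" using hull S1 .
    show "mvol Hyp (?h ` (convex hull S)) = mvol Hyp (convex hull S)"
    proof (rule antisym)
      show "mvol Hyp (?h ` (convex hull S)) \<le> mvol Hyp (convex hull S)"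
        using mvol_klein_boost_le[OF a e S(1) S1] .
      have "convex hull S \<subseteq> ball 0 1" using S1 by (rule hull_minimal) (rule convex_ball)
      from klein_boost_image_subset(2)[OF a ne this]
      show "mvol Hyp (convex hull S) \<le> mvol Hyp (?h ` (convex hull S))"
        using mvol_klein_boost_le[OF a e _ klein_boost_image_subset(1)[OF a ne S1]] S(1)
        by (simp add: klein_boost_image_hull[OF a ne S1])
    qed
  qed (auto simp: mspace_def boost hull)
qed

section \<open>The theorem\<close>

lemma minimal_iff_regular_Euclid:
  fixes V :: "(real^'m::{finite,wellorder}) set"
  assumes r: "r > 0" and V: "msimplex_vertices Euclid V" and sub: "mball Euclid c r \<subseteq> convex hull V"
  shows "minimal_iff_regular Euclid (mball Euclid c r) V"
proof -
  interpret model_isometry Euclid "\<lambda>x. x - c" "\<lambda>x. x + c" by (rule model_isometry_translation)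
  have B: "mball Euclid c r \<subseteq> mspace Euclid" by (simp add: mspace_def)
  have "(\<lambda>x. x - c) ` mball Euclid c r = cball 0 r"
    using image_mball[of c r] by (simp add: mspace_def mball_def mdist_def cball_def)
  moreover from this have "cball 0 r \<subseteq> convex hull ((\<lambda>x. x - c) ` V)"
    using image_subset_hull_iff[OF _ _ B, of V] sub V by (simp add: msimplex_vertices_def)
  ultimately have "minimal_iff_regular Euclid ((\<lambda>x. x - c) ` mball Euclid c r) ((\<lambda>x. x - c) ` V)"
    using minimal_iff_regular_circumscribed_centered[OF msimplex_vertices_image[OF V] r]
    by (simp add: minimal_iff_regular_def)
  then show ?thesis by (rule minimal_iff_regular_image[OF V B])
qed

lemma minimal_iff_regular_Hyp_axis:
  fixes V :: "(real^'m::{finite,wellorder}) set"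
  assumes a: "0 \<le> a" "a < 1" and c: "c = a *\<^sub>R axis k 1" and r: "r > 0"
    and V: "msimplex_vertices Hyp V" and sub: "mball Hyp c r \<subseteq> convex hull V"
  shows "minimal_iff_regular Hyp (mball Hyp c r) V"
proof -
  let ?h = "klein_boost a (axis k 1 :: real^'m::_)"
  interpret model_isometry Hyp ?h ?h using a refl by (rule model_isometry_klein_boost)
  have B: "mball Hyp c r \<subseteq> mspace Hyp" by (auto simp: mball_def)
  have "c \<in> mspace Hyp" using a by (simp add: c mspace_def)
  then have "?h ` mball Hyp c r = mball Hyp (?h c) r" by (rule image_mball)
  also have "?h c = 0" unfolding c by (rule klein_boost_center[OF a]) simp
  finally have im: "?h ` mball Hyp c r = cball 0 (tanh r)" using mball_Hyp_0[OF r] by simp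
  then have "cball 0 (tanh r) \<subseteq> convex hull (?h ` V)"
    using image_subset_hull_iff[OF _ _ B, of V] sub V by (simp add: msimplex_vertices_def)
  then have "minimal_iff_regular Hyp (?h ` mball Hyp c r) (?h ` V)"
    using minimal_iff_regular_circumscribed_centered[OF msimplex_vertices_image[OF V], of "tanh r"] r
    by (simp add: minimal_iff_regular_def im)
  then show ?thesis by (rule minimal_iff_regular_image[OF V B])
qed

text \<open>The Jacobian of the boost was computed along coordinate axes, so in the hyperbolic case
  a rotation first moves the centre onto an axis.\<close>

lemma minimal_iff_regular_wellorder:
  fixes V :: "(real^'m::{finite,wellorder}) set"
  assumes c: "c \<in> mspace M" and r: "r > 0"
    and V: "msimplex_vertices M V" and sub: "mball M c r \<subseteq> convex hull V"
  shows "minimal_iff_regular M (mball M c r) V"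
proof (cases M)
  case Euclid
  then show ?thesis using minimal_iff_regular_Euclid[OF r] V sub by simp
next
  case Hyp
  obtain k :: 'm where True by simp
  have "norm c = norm (norm c *\<^sub>R (axis k 1 :: real^'m::_))" by simp
  from orthogonal_transformation_exists[OF this]
  obtain Q :: "real^'m::_ \<Rightarrow> real^'m::_" where Q: "orthogonal_transformation Q" "Q c = norm c *\<^sub>R axis k 1" by blast
  interpret model_isometry Hyp Q "inv Q" using Q(1) by (rule model_isometry_orthogonal)
  have B: "mball Hyp c r \<subseteq> mspace Hyp" by (auto simp: mball_def)
  have c: "c \<in> mspace Hyp" using c Hyp by simp
  then have n: "norm c < 1" by (simp add: mspace_def)
  have V: "msimplex_vertices Hyp V" using V Hyp by simp
  have im: "Q ` mball Hyp c r = mball Hyp (Q c) r" using c by (rule image_mball)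
  have "mball Hyp (Q c) r \<subseteq> convex hull (Q ` V)"
    using image_subset_hull_iff[OF _ _ B, of V] sub V Hyp by (simp add: msimplex_vertices_def im)
  from minimal_iff_regular_Hyp_axis[OF norm_ge_zero n Q(2) r msimplex_vertices_image[OF V] this]
  have "minimal_iff_regular Hyp (Q ` mball Hyp c r) (Q ` V)" by (simp add: im)
  then show ?thesis unfolding Hyp by (rule minimal_iff_regular_image[OF V B])
qed

theorem mainTheorem6:
  fixes M :: geom and c :: "real^'n" and r :: real and V :: "(real^'n) set"
  assumes "CARD('n) \<ge> 2"
    and "c \<in> mspace M" and "r > 0"
    and "msimplex_vertices M V" and "mball M c r \<subseteq> convex hull V"
  shows "(\<forall>W. msimplex_vertices M W \<and> mball M c r \<subseteq> convex hull W
             \<longrightarrow> mvol M (convex hull V) \<le> mvol M (convex hull W))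
         \<longleftrightarrow> mregular M V \<and> circumscribed (mball M c r) V"
proof -
  \<comment> \<open>This step changes only the index type; the image of the centre is moved to the
    origin afterwards, in the new coordinates.\<close>
  obtain \<phi> :: "real^'n \<Rightarrow> real^'n index_copy" and \<psi> where "model_isometry M \<phi> \<psi>"
    by (rule model_isometry_index_copy)
  then interpret model_isometry M \<phi> \<psi> .
  have B: "mball M c r \<subseteq> mspace M" by (auto simp: mball_def)
  have im: "\<phi> ` mball M c r = mball M (\<phi> c) r" using assms(2) by (rule image_mball)
  have "mball M (\<phi> c) r \<subseteq> convex hull (\<phi> ` V)"
    using image_subset_hull_iff[OF _ _ B, of V] assms by (simp add: msimplex_vertices_def im)
  then have "minimal_iff_regular M (\<phi> ` mball M c r) (\<phi> ` V)"
    unfolding im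
    using assms by (intro minimal_iff_regular_wellorder maps msimplex_vertices_image) auto
  then have "minimal_iff_regular M (mball M c r) V"
    by (rule minimal_iff_regular_image[OF assms(4) B])
  then show ?thesis by (simp add: minimal_iff_regular_def)
qed

end
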